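(* For every frequency $\lambda=(\lambda_n)$ the following statements are equivalent: (i) Bohr's theorem holds for $\lambda$. (ii) For every $k\in\mathbb{N}$ there are $\ell>k$ and $C>0$ such that for each $\sum a_n e^{-\lambda_n s}\in\mathcal{D}_{\infty,+}(\lambda)$ we have \[ \sup_{N}\Big\|\sum_{n=1}^N a_n e^{-\lambda_n s}\Big\|_{k}\le C\,\Big\|\sum a_n e^{-\lambda_n s}\Big\|_{\ell}. \] Moreover, in this case the monomials $\{e^{-\lambda_n s}\}_n$ form a (Schauder) basis of $\mathcal{D}_{\infty,+}(\lambda)$.
   Context: A frequency is a strictly increasing unbounded sequence $\lambda=(\lambda_n)_{n\ge 1}$ of non-negative real numbers. A $\lambda$-Dirichlet series is a formal series $D=\sum a_n e^{-\lambda_n s}$ with $a_n\in\mathbb{C}$ and $s$ a complex variable. Write $[\mathrm{Re}>\sigma]=\{s\in\mathbb{C}:\mathrm{Re}\,s>\sigma\}$. If $D$ converges at some point then it converges on some half-plane, where its limit function is holomorphic. Let $\sigma_u(D)=\inf\{\sigma\in\mathbb{R}: D \text{ converges uniformly on } [\mathrm{Re}>\sigma]\}$. Bohr's theorem holds for $\lambda$ if $\sigma_u(D)\le 0$ for every $D\in\mathcal{D}_\infty^{\mathrm{ext}}(\lambda)$, where $\mathcal{D}_\infty^{\mathrm{ext}}(\lambda)$ is the space of all $\lambda$-Dirichlet series that converge somewhere and whose limit function extends to a bounded holomorphic function on $[\mathrm{Re}>0]$. $\mathcal{D}_{\infty,+}(\lambda)$ is the space of all $\lambda$-Dirichlet series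 that converge on $[\mathrm{Re}>0]$ to a (necessarily holomorphic) function which is bounded on $[\mathrm{Re}>\sigma]$ for each $\sigma>0$, with the locally convex topology given by the norms $\|D\|_{k}=\sup_{\mathrm{Re}\,s>1/k}|D(s)|$, $k\in\mathbb{N}$. A sequence $(e_n)$ in a locally convex space $E$ is a (Schauder) basis if for every $x\in E$ there is a unique scalar sequence $(\alpha_n)$ with $x=\sum_{n=1}^\infty\alpha_n e_n$ (convergence in $E$). *)

theory Defs
  imports "HOL-Analysis.Analysis" "HOL-Library.Function_Algebras"
begin

text \<open>Sequences are indexed from 0, so index \<open>n\<close> here is index \<open>n + 1\<close> of the usual
  indexing by \<open>n \<ge> 1\<close>. Once a frequency \<open>lam\<close> is fixed, a formal \<open>lam\<close>-Dirichlet series is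
  represented by its coefficient sequence.\<close>

definition frequency :: "(nat \<Rightarrow> real) \<Rightarrow> bool" where
  "frequency lam \<longleftrightarrow> strict_mono lam \<and> (\<forall>n. 0 \<le> lam n) \<and> \<not> bdd_above (range lam)"

abbreviation half_plane :: "real \<Rightarrow> complex set" where
  "half_plane \<sigma> \<equiv> {s. Re s > \<sigma>}"

definition dir_term :: "(nat \<Rightarrow> real) \<Rightarrow> (nat \<Rightarrow> complex) \<Rightarrow> complex \<Rightarrow> nat \<Rightarrow> complex" where
  "dir_term lam a s n = a n * exp (- (complex_of_real (lam n) * s))"

definition dir_sum :: "(nat \<Rightarrow> real) \<Rightarrow> (nat \<Rightarrow> complex) \<Rightarrow> complex \<Rightarrow> complex" where
  "dir_sum lam a s = (\<Sum>n. dir_term lam a s n)"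

definition abscissa_conv :: "(nat \<Rightarrow> real) \<Rightarrow> (nat \<Rightarrow> complex) \<Rightarrow> ereal" where
  "abscissa_conv lam a =
     Inf {ereal \<sigma> | \<sigma>. \<forall>s\<in>half_plane \<sigma>. summable (dir_term lam a s)}"

definition abscissa_unif :: "(nat \<Rightarrow> real) \<Rightarrow> (nat \<Rightarrow> complex) \<Rightarrow> ereal" where
  "abscissa_unif lam a =
     Inf {ereal \<sigma> | \<sigma>. uniformly_convergent_on (half_plane \<sigma>) (\<lambda>N s. \<Sum>n\<le>N. dir_term lam a s n)}"

text \<open>The limit function lives on the open half-plane to the right of \<open>abscissa_conv\<close>; an
  extension to \<open>half_plane 0\<close> has to agree with it wherever both are defined.\<close>

definition D_inf_ext :: "(nat \<Rightarrow> real) \<Rightarrow> (nat \<Rightarrow> complex) set" where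
  "D_inf_ext lam = {a. (\<exists>s. summable (dir_term lam a s)) \<and>
     (\<exists>f. f holomorphic_on half_plane 0 \<and> bounded (f ` half_plane 0) \<and>
        (\<forall>s\<in>half_plane 0. abscissa_conv lam a < ereal (Re s) \<longrightarrow> f s = dir_sum lam a s))}"

definition bohr_theorem_holds :: "(nat \<Rightarrow> real) \<Rightarrow> bool" where
  "bohr_theorem_holds lam \<longleftrightarrow> (\<forall>a\<in>D_inf_ext lam. abscissa_unif lam a \<le> 0)"

definition D_inf_plus :: "(nat \<Rightarrow> real) \<Rightarrow> (nat \<Rightarrow> complex) set" where
  "D_inf_plus lam = {a. (\<forall>s\<in>half_plane 0. summable (dir_term lam a s)) \<and>
     (\<forall>\<sigma>>0. bounded (dir_sum lam a ` half_plane \<sigma>))}"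

text \<open>The norms are indexed by \<open>k \<ge> 1\<close>; note that \<open>1 / 0 = 0\<close>, so \<open>k = 0\<close> must be excluded
  explicitly where the norms are used. Values in \<open>ereal\<close> keep suprema meaningful without a
  boundedness proof.\<close>

definition dir_norm :: "(nat \<Rightarrow> real) \<Rightarrow> nat \<Rightarrow> (nat \<Rightarrow> complex) \<Rightarrow> ereal" where
  "dir_norm lam k a = (SUP s\<in>half_plane (1 / real k). ereal (norm (dir_sum lam a s)))"

definition dir_partial :: "nat \<Rightarrow> (nat \<Rightarrow> complex) \<Rightarrow> nat \<Rightarrow> complex" where
  "dir_partial N a = (\<lambda>n. if n \<le> N then a n else 0)"

definition dir_monomial :: "nat \<Rightarrow> nat \<Rightarrow> complex" where
  "dir_monomial n = (\<lambda>m. if m = n then 1 else 0)"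

definition dir_scale :: "complex \<Rightarrow> (nat \<Rightarrow> complex) \<Rightarrow> nat \<Rightarrow> complex" where
  "dir_scale c a = (\<lambda>n. c * a n)"

text \<open>The topology on \<open>E\<close> generated by the seminorms \<open>p i\<close>, \<open>i \<in> I\<close>: all open balls with
  respect to single seminorms form a subbasis.\<close>

definition seminorm_topology ::
    "'a::ab_group_add set \<Rightarrow> 'i set \<Rightarrow> ('i \<Rightarrow> 'a \<Rightarrow> ereal) \<Rightarrow> 'a topology" where
  "seminorm_topology E I p = topology_generated_by
     {{y\<in>E. p i (y - x) < ereal \<epsilon>} | x i \<epsilon>. x \<in> E \<and> i \<in> I \<and> \<epsilon> > 0}"

definition schauder_basis ::
    "('k \<Rightarrow> 'a::ab_group_add \<Rightarrow> 'a) \<Rightarrow> 'a topology \<Rightarrow> (nat \<Rightarrow> 'a) \<Rightarrow> bool" where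
  "schauder_basis smul T e \<longleftrightarrow> (\<forall>n. e n \<in> topspace T) \<and>
     (\<forall>x\<in>topspace T. \<exists>!\<alpha>. limitin T (\<lambda>N. \<Sum>n\<le>N. smul (\<alpha> n) (e n)) x sequentially)"

definition D_inf_plus_topology :: "(nat \<Rightarrow> real) \<Rightarrow> (nat \<Rightarrow> complex) topology" where
  "D_inf_plus_topology lam = seminorm_topology (D_inf_plus lam) {1..} (dir_norm lam)"

lemma dir_norm_zero: "dir_norm lam k 0 = 0"
proof -
  have "half_plane (1 / real k) \<noteq> {}"
    by (metis (mono_tags, lifting) complex.sel(1) empty_iff gt_ex mem_Collect_eq)
  then show ?thesis
    by (simp add: dir_norm_def dir_sum_def dir_term_def zero_ereal_def)
qed

lemma topspace_D_inf_plus_topology: "topspace (D_inf_plus_topology lam) = D_inf_plus lam"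
proof
  show "topspace (D_inf_plus_topology lam) \<subseteq> D_inf_plus lam"
    unfolding D_inf_plus_topology_def seminorm_topology_def topology_generated_by_topspace
    by blast
  show "D_inf_plus lam \<subseteq> topspace (D_inf_plus_topology lam)"
  proof
    fix x assume x: "x \<in> D_inf_plus lam"
    let ?U = "{y \<in> D_inf_plus lam. dir_norm lam 1 (y - x) < ereal 1}"
    have "x \<in> ?U" using x by (simp add: dir_norm_zero)
    moreover have "?U \<in> {{y\<in>D_inf_plus lam. dir_norm lam i (y - x) < ereal \<epsilon>} | x i \<epsilon>.
        x \<in> D_inf_plus lam \<and> i \<in> {1..} \<and> \<epsilon> > 0}"
      using x by (intro CollectI exI[of _ x] exI[of _ "1::nat"] exI[of _ "1::real"]) auto
    ultimately show "x \<in> topspace (D_inf_plus_topology lam)"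
      unfolding D_inf_plus_topology_def seminorm_topology_def topology_generated_by_topspace
      by (meson UnionI)
  qed
qed

end

theory Submission
  imports Defs "HOL-Complex_Analysis.Complex_Analysis" "HOL-Probability.Probability"
begin

text \<open>
  Suppose first that partial sums are controlled by the limit function, and let a series have a
  bounded extension \<open>f\<close> to the right half-plane. The series itself need not converge there, so the
  estimate is applied to smoothed series instead. Averaging \<open>f\<close> along vertical lines
  against a centred Gaussian of standard deviation \<open>\<epsilon>\<close> gives a function with the same bound as
  \<open>f\<close> (\<open>norm_gaussian_damping_le\<close>), and it multiplies the coefficients by
  \<open>exp (- (\<epsilon> \<lambda>\<^sub>n)\<^sup>2 / 2)\<close>, which makes the series converge everywhere
  (\<open>summable_gaussian_damping\<close>). The resulting bound for the damped partial
  sums is independent of \<open>\<epsilon>\<close>; as \<open>\<epsilon>\<close> tends to 0 it passes to the original partial sums,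
  and Abel summation turns bounded partial sums into uniform convergence slightly further right.

  Conversely, suppose that Bohr's theorem holds. Every series in the space then converges uniformly
  on smaller half-planes, so its partial sums are bounded there, but not yet uniformly over all
  series. If the uniform estimate failed, a gliding hump would contradict Bohr's theorem: one picks
  series \<open>q\<^sub>j\<close>, very small as functions, each with a large partial sum on \<open>Re s > \<delta>\<close>, and adds
  them up. The sum of the limit functions is bounded and holomorphic, and the partial sums of the
  added series are unbounded on \<open>Re s > \<delta>\<close>. What has to be ensured is that the added
  series converges at all. Coefficients are bounded by the limit function, so an initial segment of
  prescribed length of \<open>q\<^sub>j\<close> is negligible, and the remaining frequencies are so large that moving
  one unit to the right makes even the large partial sums negligible
  (\<open>dir_psum_shift_small\<close>). Hence the added series converges on \<open>Re s > \<delta> + 1\<close>, and its limit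
  function is the sum of the limit functions (\<open>bohr_partial_sum_bound\<close>).

  The monomials form a basis because the uniform convergence given by Bohr's theorem is
  convergence in every norm of the space, while the coefficient bound makes the coefficients
  continuous functionals and hence unique.
\<close>

section \<open>Abel summation\<close>

lemma summation_by_parts:
  fixes c v :: "nat \<Rightarrow> 'a::comm_ring"
  assumes "M \<le> N"
  shows "(\<Sum>i=M..N. c i * v i) =
    (\<Sum>i=M..<N. (\<Sum>j=M..i. c j) * (v i - v (Suc i))) + (\<Sum>j=M..N. c j) * v N"
  using assms
proof (induction N rule: dec_induct)
  case base
  show ?case by simp
next
  case (step n)
  then show ?case by (simp add: algebra_simps)
qed

lemma abel_bound:
  fixes c v :: "nat \<Rightarrow> 'a::{comm_ring,real_normed_algebra}"
  assumes "M \<le> N" and sums: "\<And>n. M \<le> n \<Longrightarrow> n \<le> N \<Longrightarrow> norm (\<Sum>i=M..n. c i) \<le> \<epsilon>"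
    and var: "(\<Sum>i=M..<N. norm (v i - v (Suc i))) + norm (v N) \<le> V"
  shows "norm (\<Sum>i=M..N. c i * v i) \<le> \<epsilon> * V"
proof -
  have "0 \<le> norm (\<Sum>i=M..N. c i)" by simp
  also have "\<dots> \<le> \<epsilon>" using sums[of N] assms(1) by simp
  finally have \<epsilon>: "0 \<le> \<epsilon>" .
  have "norm (\<Sum>i=M..N. c i * v i) \<le>
    (\<Sum>i=M..<N. norm ((\<Sum>j=M..i. c j) * (v i - v (Suc i)))) + norm ((\<Sum>j=M..N. c j) * v N)"
    unfolding summation_by_parts[OF assms(1)]
    by (intro order_trans[OF norm_triangle_ineq] add_mono norm_sum order_refl)
  also have "\<dots> \<le> (\<Sum>i=M..<N. \<epsilon> * norm (v i - v (Suc i))) + \<epsilon> * norm (v N)"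
    using assms(1)
    by (intro add_mono sum_mono order_trans[OF norm_mult_ineq] mult_right_mono sums) auto
  also have "\<dots> = \<epsilon> * ((\<Sum>i=M..<N. norm (v i - v (Suc i))) + norm (v N))"
    by (simp add: sum_distrib_left distrib_left)
  also have "\<dots> \<le> \<epsilon> * V" using var \<epsilon> by (rule mult_left_mono)
  finally show ?thesis .
qed

text \<open>The total variation of \<open>t \<mapsto> exp (- t w)\<close> is \<open>norm w / Re w\<close> times the one of its modulus.
  This is the mean value inequality, comparing the two derivatives.\<close>

lemma norm_exp_diff_le:
  assumes "Re w > 0" "x \<le> y"
  shows "norm (exp (- (complex_of_real x * w)) - exp (- (complex_of_real y * w)))
    \<le> norm w / Re w * (exp (- (x * Re w)) - exp (- (y * Re w)))"
proof (cases "x = y")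
  case False
  let ?f = "\<lambda>t::real. exp (- (complex_of_real t * w))"
  let ?\<phi> = "\<lambda>t::real. - (norm w / Re w * exp (- (t * Re w)))"
  have "norm (?f y - ?f x) \<le> ?\<phi> y - ?\<phi> x"
  proof (rule differentiable_bound_general)
    show "x < y" using False assms by simp
    show "continuous_on {x..y} ?f" "continuous_on {x..y} ?\<phi>"
      using assms by (auto intro!: continuous_intros)
    fix t :: real
    have "((\<lambda>z. exp (- (z * w))) has_field_derivative exp (- (complex_of_real t * w)) * (- w))
        (at (complex_of_real t))"
      by (auto intro!: derivative_eq_intros)
    then show "(?f has_vector_derivative exp (- (complex_of_real t * w)) * (- w)) (at t)"
      by (rule has_vector_derivative_real_field)
    show "(?\<phi> has_vector_derivative norm w * exp (- (t * Re w))) (at t)"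
      unfolding has_real_derivative_iff_has_vector_derivative[symmetric]
      using assms by (auto intro!: derivative_eq_intros)
    show "norm (exp (- (complex_of_real t * w)) * (- w)) \<le> norm w * exp (- (t * Re w))"
      by (simp add: norm_mult)
  qed
  then show ?thesis by (simp add: norm_minus_commute algebra_simps)
qed simp

section \<open>Convergence of Dirichlet series\<close>

abbreviation dir_psum :: "(nat \<Rightarrow> real) \<Rightarrow> (nat \<Rightarrow> complex) \<Rightarrow> nat \<Rightarrow> complex \<Rightarrow> complex" where
  "dir_psum lam a N s \<equiv> \<Sum>n\<le>N. dir_term lam a s n"

lemma dir_term_add:
  "dir_term lam a (s + w) n = dir_term lam a s n * exp (- (complex_of_real (lam n) * w))"
  by (simp add: dir_term_def algebra_simps exp_add[symmetric])

lemma norm_dir_term: "norm (dir_term lam a s n) = norm (a n) * exp (- (lam n * Re s))"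
  by (simp add: dir_term_def norm_mult)

lemma dir_partial_term: "dir_term lam (dir_partial N a) s n = (if n \<le> N then dir_term lam a s n else 0)"
  by (simp add: dir_term_def dir_partial_def)

lemma dir_partial_sums: "dir_term lam (dir_partial N a) s sums dir_psum lam a N s"
  unfolding dir_partial_term using sums_If_finite_set[of "{..N}" "dir_term lam a s"] by simp

lemma dir_sum_partial [simp]: "dir_sum lam (dir_partial N a) s = dir_psum lam a N s"
  unfolding dir_sum_def using dir_partial_sums by (rule sums_unique[symmetric])

lemma dir_psum_tendsto:
  "summable (dir_term lam a s) \<Longrightarrow> (\<lambda>N. dir_psum lam a N s) \<longlonglongrightarrow> dir_sum lam a s"
  unfolding dir_sum_def by (rule summable_LIMSEQ')

lemma uniformly_convergent_dir_psum:
  assumes "uniformly_convergent_on S (dir_psum lam a)"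
  shows "uniform_limit S (dir_psum lam a) (dir_sum lam a) sequentially"
    and "s \<in> S \<Longrightarrow> summable (dir_term lam a s)"
proof -
  obtain l where l: "uniform_limit S (dir_psum lam a) l sequentially"
    using assms unfolding uniformly_convergent_on_def by blast
  have s: "dir_term lam a s sums l s" if "s \<in> S" for s
    using tendsto_uniform_limitI[OF l that] by (simp add: sums_def_le)
  then show "s \<in> S \<Longrightarrow> summable (dir_term lam a s)" by (auto simp: sums_iff)
  from s have "\<And>s. s \<in> S \<Longrightarrow> l s = dir_sum lam a s" by (auto simp: dir_sum_def sums_iff)
  with l show "uniform_limit S (dir_psum lam a) (dir_sum lam a) sequentially"
    by (metis (no_types, lifting) uniform_limit_cong')
qed

lemma holomorphic_dir_psum: "dir_psum lam a N holomorphic_on S"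
  unfolding dir_term_def by (intro holomorphic_intros)

lemma abscissa_unif_lessD:
  assumes "abscissa_unif lam a < ereal \<sigma>"
  shows "uniformly_convergent_on (half_plane \<sigma>) (dir_psum lam a)"
proof -
  obtain \<sigma>' where "\<sigma>' < \<sigma>" "uniformly_convergent_on (half_plane \<sigma>') (dir_psum lam a)"
    using assms unfolding abscissa_unif_def Inf_less_iff by auto
  then show ?thesis by (elim uniformly_convergent_on_subset) auto
qed

lemma abscissa_unif_nonpos:
  assumes "\<And>\<sigma>. \<sigma> > 0 \<Longrightarrow> uniformly_convergent_on (half_plane \<sigma>) (dir_psum lam a)"
  shows "abscissa_unif lam a \<le> 0"
proof (rule ereal_le_epsilon2)
  fix e :: real assume "e > 0"
  from assms[OF this] show "abscissa_unif lam a \<le> 0 + ereal e"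
    unfolding abscissa_unif_def by (intro Inf_lower) auto
qed

lemma dir_norm_le_iff:
  "dir_norm lam k a \<le> ereal B \<longleftrightarrow> (\<forall>s. Re s > 1 / real k \<longrightarrow> norm (dir_sum lam a s) \<le> B)"
  unfolding dir_norm_def by (auto simp: SUP_le_iff)

context
  fixes lam :: "nat \<Rightarrow> real"
  assumes freq: "frequency lam"
begin

lemma lam_nonneg: "0 \<le> lam n" and lam_mono: "m \<le> n \<Longrightarrow> lam m \<le> lam n"
  and lam_inj: "lam m = lam n \<longleftrightarrow> m = n"
  using freq by (auto simp: frequency_def strict_mono_eq strict_mono_less_eq)

lemma lam_at_top: "filterlim lam at_top sequentially"
  unfolding filterlim_at_top
proof
  fix Z
  obtain n where "lam n > Z"
    using freq unfolding frequency_def bdd_above_def by (metis not_le rangeE)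
  then show "eventually (\<lambda>n. Z \<le> lam n) sequentially"
    using lam_mono unfolding eventually_sequentially
    by (metis less_eq_real_def order_trans)
qed

text \<open>The basic estimate on moving a block of terms to the right by \<open>w\<close>. For real \<open>w\<close> the
  quotient is 1 and the exponential factor is a true gain; for complex \<open>w\<close> the quotient bounds the
  aperture of the sector in which the estimate is uniform.\<close>

lemma dir_block_bound:
  assumes "M \<le> N" and sums: "\<And>n. M \<le> n \<Longrightarrow> n \<le> N \<Longrightarrow> norm (\<Sum>i=M..n. dir_term lam a s i) \<le> \<epsilon>"
    and w: "Re w > 0"
  shows "norm (\<Sum>i=M..N. dir_term lam a (s + w) i) \<le> \<epsilon> * (norm w / Re w * exp (- (lam M * Re w)))"
proof -
  let ?v = "\<lambda>i. exp (- (complex_of_real (lam i) * w))"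
  let ?e = "\<lambda>i. exp (- (lam i * Re w))"
  have "(\<Sum>i=M..<N. norm (?v i - ?v (Suc i))) \<le> (\<Sum>i=M..<N. norm w / Re w * (?e i - ?e (Suc i)))"
    by (intro sum_mono norm_exp_diff_le w lam_mono) simp
  also have "\<dots> = norm w / Re w * (?e M - ?e N)"
    using sum_Suc_diff'[OF assms(1), of "\<lambda>i. - ?e i"]
    by (simp only: sum_distrib_left[symmetric]) simp
  finally have 1: "(\<Sum>i=M..<N. norm (?v i - ?v (Suc i))) \<le> norm w / Re w * (?e M - ?e N)" .
  have "1 * ?e N \<le> norm w / Re w * ?e N"
    using w complex_Re_le_cmod[of w] by (intro mult_right_mono) auto
  with 1 have "(\<Sum>i=M..<N. norm (?v i - ?v (Suc i))) + norm (?v N) \<le> norm w / Re w * ?e M"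
    by (simp add: right_diff_distrib)
  from abel_bound[OF assms(1) sums this] show ?thesis
    by (simp add: dir_term_add)
qed

lemma dir_psum_bound:
  assumes "\<And>n. norm (dir_psum lam a n s0) \<le> B" "Re s > Re s0"
  shows "norm (dir_psum lam a N s) \<le> B * (norm (s - s0) / (Re s - Re s0))"
proof -
  have B: "0 \<le> B" using norm_ge_zero assms(1) by (rule order_trans)
  have "norm (\<Sum>i=0..N. dir_term lam a (s0 + (s - s0)) i)
    \<le> B * (norm (s - s0) / Re (s - s0) * exp (- (lam 0 * Re (s - s0))))"
    by (rule dir_block_bound) (use assms in \<open>simp_all add: atLeast0AtMost\<close>)
  also have "\<dots> \<le> B * (norm (s - s0) / Re (s - s0) * 1)"
    using assms lam_nonneg B by (intro mult_left_mono) auto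
  finally show ?thesis by (simp add: atLeast0AtMost)
qed

text \<open>Convergence at one point gives uniform convergence in sectors with that vertex. This is
  stronger than locally uniform convergence and yields the half-plane of
  convergence as well as holomorphy.\<close>

lemma uniform_limit_sector:
  assumes "summable (dir_term lam a s0)"
  shows "uniform_limit {s. Re s > Re s0 \<and> norm (s - s0) \<le> K * (Re s - Re s0)}
    (dir_psum lam a) (dir_sum lam a) sequentially" (is "uniform_limit ?S _ _ _")
proof -
  have "uniformly_convergent_on ?S (dir_psum lam a)"
  proof (rule Cauchy_uniformly_convergent, rule uniformly_Cauchy_onI')
    fix e :: real assume e: "e > 0"
    define \<epsilon> where "\<epsilon> = e / (2 * (\<bar>K\<bar> + 1))"
    have \<epsilon>: "\<epsilon> > 0" using e by (simp add: \<epsilon>_def)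
    obtain M where M: "\<And>m n. m \<ge> M \<Longrightarrow> norm (sum (dir_term lam a s0) {m..<n}) < \<epsilon>"
      using assms \<epsilon> unfolding summable_Cauchy by meson
    have "dist (dir_psum lam a m s) (dir_psum lam a n s) < e"
      if s: "s \<in> ?S" and mn: "m \<ge> M" "n > m" for s m n
    proof -
      have "dir_psum lam a n s - dir_psum lam a m s = (\<Sum>i=Suc m..n. dir_term lam a (s0 + (s - s0)) i)"
        using sum_up_index_split[of "dir_term lam a s" m "n - m"] mn by simp
      also have "norm \<dots> \<le> \<epsilon> * (norm (s - s0) / Re (s - s0) * exp (- (lam (Suc m) * Re (s - s0))))"
      proof (rule dir_block_bound)
        show "norm (\<Sum>i=Suc m..k. dir_term lam a s0 i) \<le> \<epsilon>" for k
          using M[of "Suc m" "Suc k"] mn by (simp add: atLeastLessThanSuc_atLeastAtMost)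
      qed (use s mn in auto)
      also have "\<dots> \<le> \<epsilon> * (\<bar>K\<bar> * 1)"
      proof (intro mult_left_mono mult_mono)
        have "norm (s - s0) \<le> K * (Re s - Re s0)" using s by simp
        also have "\<dots> \<le> \<bar>K\<bar> * (Re s - Re s0)" using s by (intro mult_right_mono) auto
        finally show "norm (s - s0) / Re (s - s0) \<le> \<bar>K\<bar>" using s by (simp add: divide_le_eq)
      qed (use s lam_nonneg \<epsilon> in auto)
      also have "\<dots> \<le> e / 2"
        using e by (simp add: \<epsilon>_def field_simps)
      also have "\<dots> < e" using e by simp
      finally show ?thesis by (simp add: dist_norm norm_minus_commute)
    qed
    then show "\<exists>M. \<forall>x\<in>?S. \<forall>m\<ge>M. \<forall>n>m. dist (dir_psum lam a m x) (dir_psum lam a n x) < e"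
      by blast
  qed
  then show ?thesis by (rule uniformly_convergent_dir_psum)
qed

lemma dir_summable_right:
  assumes "summable (dir_term lam a s0)" "Re s > Re s0"
  shows "summable (dir_term lam a s)"
proof -
  have "s \<in> {s'. Re s' > Re s0 \<and> norm (s' - s0) \<le> norm (s - s0) / (Re s - Re s0) * (Re s' - Re s0)}"
    using assms by simp
  from tendsto_uniform_limitI[OF uniform_limit_sector[OF assms(1)] this]
  show ?thesis by (auto simp: summable_def sums_def_le)
qed

lemma holomorphic_dir_sum:
  assumes "\<And>\<sigma>'. \<sigma>' > \<sigma> \<Longrightarrow> summable (dir_term lam a (of_real \<sigma>'))"
  shows "dir_sum lam a holomorphic_on half_plane \<sigma>"
proof (rule holomorphic_uniform_sequence)
  show "open (half_plane \<sigma>)" by (rule open_halfspace_Re_gt)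
  show "dir_psum lam a n holomorphic_on half_plane \<sigma>" for n by (rule holomorphic_dir_psum)
  fix z assume z: "z \<in> half_plane \<sigma>"
  \<comment> \<open>A disc of radius \<open>d\<close> around \<open>z\<close> lies in a sector with vertex on the real axis.\<close>
  define d where "d = (Re z - \<sigma>) / 3"
  have d: "d > 0" using z by (simp add: d_def)
  let ?s0 = "complex_of_real (\<sigma> + d)"
  let ?S = "{s. Re s > Re ?s0 \<and> norm (s - ?s0) \<le> (norm (z - ?s0) + d) / d * (Re s - Re ?s0)}"
  have re: "Re s \<ge> \<sigma> + 2 * d" if "s \<in> cball z d" for s
    using that complex_Re_le_cmod[of "z - s"] by (simp add: dist_norm d_def field_simps)
  have "cball z d \<subseteq> ?S"
  proof (clarify, intro conjI)
    fix s assume s: "s \<in> cball z d"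
    show "Re s > Re ?s0" using re[OF s] d by simp
    have "norm (s - ?s0) \<le> norm (z - ?s0) + d"
      using dist_triangle[of s ?s0 z] s unfolding mem_cball dist_norm norm_minus_commute[of z s] by linarith
    also have "\<dots> = (norm (z - ?s0) + d) / d * d" using d by simp
    also have "\<dots> \<le> (norm (z - ?s0) + d) / d * (Re s - Re ?s0)"
      using re[OF s] d by (intro mult_left_mono) auto
    finally show "norm (s - ?s0) \<le> (norm (z - ?s0) + d) / d * (Re s - Re ?s0)" .
  qed
  moreover have "uniform_limit ?S (dir_psum lam a) (dir_sum lam a) sequentially"
    using assms[of "\<sigma> + d"] d by (intro uniform_limit_sector) simp
  moreover have "cball z d \<subseteq> half_plane \<sigma>" using re d by force
  ultimately show "\<exists>d. 0 < d \<and> cball z d \<subseteq> half_plane \<sigma> \<and>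
      uniform_limit (cball z d) (dir_psum lam a) (dir_sum lam a) sequentially"
    using d uniform_limit_on_subset by blast
qed

text \<open>By the identity theorem, an extension need only be compared with the series far to the
  right.\<close>

lemma dir_sum_eq_extension:
  assumes f: "f holomorphic_on half_plane 0"
    and conv: "\<And>\<sigma>'. \<sigma>' > \<sigma> \<Longrightarrow> summable (dir_term lam a (of_real \<sigma>'))"
    and eq: "\<And>s. Re s > \<rho> \<Longrightarrow> f s = dir_sum lam a s"
    and s: "Re s > 0" "Re s > \<sigma>"
  shows "f s = dir_sum lam a s"
proof (rule analytic_continuation_open[where s = "half_plane (max \<rho> (max 0 \<sigma>))"
      and s' = "half_plane (max 0 \<sigma>)" and f = f and g = "dir_sum lam a"])
  let ?T = "half_plane (max 0 \<sigma>)"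
  show "open (half_plane (max \<rho> (max 0 \<sigma>)))" "open ?T" by (rule open_halfspace_Re_gt)+
  show "half_plane (max \<rho> (max 0 \<sigma>)) \<noteq> {}"
    by (metis (mono_tags, lifting) complex.sel(1) empty_iff gt_ex mem_Collect_eq)
  show "connected ?T" by (intro convex_connected convex_halfspace_Re_gt)
  show "f holomorphic_on ?T" by (rule holomorphic_on_subset[OF f]) auto
  show "dir_sum lam a holomorphic_on ?T"
    by (rule holomorphic_dir_sum) (use conv in auto)
qed (use eq s in auto)

end

section \<open>Coefficient bounds\<close>

lemma mean_power_tendsto_0:
  fixes z :: complex
  assumes "norm z = 1" "z \<noteq> 1"
  shows "(\<lambda>M. (\<Sum>j<M. z ^ j) / of_nat M) \<longlonglongrightarrow> 0"
proof (rule Lim_null_comparison)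
  show "(\<lambda>M. 2 / norm (z - 1) * inverse (real M)) \<longlonglongrightarrow> 0"
    by (rule tendsto_mult_right_zero[OF lim_inverse_n])
  show "\<forall>\<^sub>F M in sequentially. norm ((\<Sum>j<M. z ^ j) / of_nat M) \<le> 2 / norm (z - 1) * inverse (real M)"
  proof (rule always_eventually, rule allI)
    fix M
    have "norm (z ^ M - 1) \<le> 2"
      using norm_triangle_ineq4[of "z ^ M" 1] assms by (simp add: norm_power)
    moreover have "norm ((\<Sum>j<M. z ^ j) / of_nat M) = norm (z ^ M - 1) / norm (z - 1) / real M"
      using assms by (simp add: geometric_sum norm_divide norm_mult)
    ultimately have "norm ((\<Sum>j<M. z ^ j) / of_nat M) \<le> 2 / norm (z - 1) / real M"
      by (simp add: divide_right_mono)
    then show "norm ((\<Sum>j<M. z ^ j) / of_nat M) \<le> 2 / norm (z - 1) * inverse (real M)"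
      by (simp only: divide_inverse)
  qed
qed

lemma exp_imaginary_neq_1:
  assumes "\<theta> \<noteq> 0" "\<bar>\<theta>\<bar> < 1"
  shows "exp (\<i> * complex_of_real \<theta>) \<noteq> 1"
proof
  assume "exp (\<i> * complex_of_real \<theta>) = 1"
  then have "sin \<theta> = 0" "\<bar>\<theta>\<bar> < pi"
    using assms pi_gt3 by (auto simp: complex_eq_iff Im_exp)
  then show False
    using assms sin_gt_zero[of \<theta>] sin_gt_zero[of "-\<theta>"] by (cases "\<theta> > 0") auto
qed

lemma norm_dir_psum_le:
  assumes "\<And>n. n \<le> N \<Longrightarrow> norm (a n) * exp (- (lam n * \<sigma>)) \<le> B" "Re s \<ge> \<sigma>" "\<And>n. lam n \<ge> 0"
  shows "norm (dir_psum lam a N s) \<le> real (Suc N) * B"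
proof -
  have "norm (dir_term lam a s n) \<le> B" if "n \<le> N" for n
  proof -
    have "norm (dir_term lam a s n) \<le> norm (a n) * exp (- (lam n * \<sigma>))"
      unfolding norm_dir_term using assms(2,3) by (intro mult_left_mono) (auto intro: mult_left_mono)
    with assms(1)[OF that] show ?thesis by linarith
  qed
  then have "(\<Sum>n\<le>N. norm (dir_term lam a s n)) \<le> (\<Sum>n\<le>N. B)" by (intro sum_mono) simp
  then show ?thesis using norm_sum[of "dir_term lam a s" "{..N}"] by simp
qed

context
  fixes lam :: "nat \<Rightarrow> real"
  assumes freq: "frequency lam"
begin

text \<open>The coefficient of index \<open>m\<close> is recovered by averaging the series, multiplied by
  \<open>exp (\<lambda>\<^sub>m s)\<close>, along a vertical line. A mean over equidistant points suffices in place of an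
  integral: the other terms become means of powers of a unimodular number different from 1.\<close>

lemma dir_psum_coeff_bound:
  assumes m: "m \<le> N" and bound: "\<And>t. norm (dir_psum lam a N (Complex \<sigma> t)) \<le> B"
  shows "norm (a m) * exp (- (lam m * \<sigma>)) \<le> B"
proof -
  \<comment> \<open>The step is so small that \<open>(lam m - lam n) * \<delta>\<close> is never a nonzero multiple of \<open>2 * pi\<close>.\<close>
  define \<delta> where "\<delta> = 1 / (lam N + 1)"
  define z where "z n = exp (\<i> * complex_of_real ((lam m - lam n) * \<delta>))" for n
  define c where "c n = a n * exp (- complex_of_real (lam n * \<sigma>))" for n
  define S where "S M = (\<Sum>j<M. dir_psum lam a N (Complex \<sigma> (real j * \<delta>)) *
    exp (\<i> * complex_of_real (lam m * (real j * \<delta>)))) / of_nat M" for M :: nat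
  have "dir_term lam a (Complex \<sigma> (j * \<delta>)) n * exp (\<i> * complex_of_real (lam m * (j * \<delta>)))
      = c n * z n ^ j" for n j :: nat
    unfolding dir_term_def c_def z_def
    by (simp add: exp_of_nat_mult[symmetric] exp_add[symmetric] Complex_eq algebra_simps)
  then have S_eq: "S M = (\<Sum>n\<le>N. c n * ((\<Sum>j<M. z n ^ j) / of_nat M))" for M
    unfolding S_def sum_divide_distrib sum_distrib_left sum_distrib_right
    by (subst sum.swap) simp
  have z: "norm (z n) = 1" for n by (simp add: z_def)
  have zn: "z n \<noteq> 1" if "n \<noteq> m" "n \<le> N" for n
    unfolding z_def
  proof (rule exp_imaginary_neq_1)
    have "\<bar>lam m - lam n\<bar> < lam N + 1"
      using lam_nonneg[OF freq, of m] lam_nonneg[OF freq, of n] lam_mono[OF freq m]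
        lam_mono[OF freq \<open>n \<le> N\<close>] by linarith
    then show "\<bar>(lam m - lam n) * \<delta>\<bar> < 1" by (simp add: \<delta>_def abs_mult)
    show "(lam m - lam n) * \<delta> \<noteq> 0"
      using that lam_inj[OF freq] lam_nonneg[OF freq, of N] by (auto simp: \<delta>_def)
  qed
  have "(\<lambda>M. \<Sum>n\<le>N. c n * ((\<Sum>j<M. z n ^ j) / of_nat M)) \<longlonglongrightarrow> (\<Sum>n\<le>N. c n * (if n = m then 1 else 0))"
  proof (intro tendsto_sum tendsto_mult_left)
    fix n assume n: "n \<in> {..N}"
    show "(\<lambda>M. (\<Sum>j<M. z n ^ j) / of_nat M) \<longlonglongrightarrow> (if n = m then 1 else 0)"
    proof (cases "n = m")
      case True
      have "\<forall>\<^sub>F M in sequentially. (\<Sum>j<M. z n ^ j) / of_nat M = 1"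
        by (rule eventually_mono[OF eventually_gt_at_top[of 0]]) (simp add: True z_def)
      with True show ?thesis by (simp add: tendsto_eventually)
    qed (use mean_power_tendsto_0[OF z zn] n in auto)
  qed
  then have "S \<longlonglongrightarrow> c m"
    using m by (simp add: S_eq[abs_def] if_distrib cong: if_cong)
  moreover have "norm (S M) \<le> B" if "M > 0" for M
  proof -
    have "norm (\<Sum>j<M. dir_psum lam a N (Complex \<sigma> (real j * \<delta>)) *
        exp (\<i> * complex_of_real (lam m * (real j * \<delta>))))
      \<le> (\<Sum>j<M. B)"
      using bound by (intro order_trans[OF norm_sum] sum_mono) (simp add: norm_mult)
    then show ?thesis using that by (simp add: S_def norm_divide divide_le_eq mult.commute)
  qed
  ultimately have "norm (c m) \<le> B"
    by (intro Lim_norm_ubound[of sequentially S]) (auto intro: eventually_mono[OF eventually_gt_at_top[of 0]])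
  then show ?thesis by (simp add: c_def norm_mult)
qed

lemma dir_sum_coeff_bound:
  assumes unif: "uniform_limit {s. Re s = \<sigma>} (dir_psum lam a) (dir_sum lam a) sequentially"
    and bound: "\<And>s. Re s = \<sigma> \<Longrightarrow> norm (dir_sum lam a s) \<le> B"
  shows "norm (a m) * exp (- (lam m * \<sigma>)) \<le> B"
proof (rule field_le_epsilon)
  fix e :: real assume "e > 0"
  then have "\<forall>\<^sub>F N in sequentially. \<forall>s\<in>{s. Re s = \<sigma>}. dist (dir_psum lam a N s) (dir_sum lam a s) < e"
    using unif by (rule uniform_limitD[rotated])
  with eventually_ge_at_top[of m]
  have "\<forall>\<^sub>F N in sequentially. m \<le> N \<and>
      (\<forall>s\<in>{s. Re s = \<sigma>}. dist (dir_psum lam a N s) (dir_sum lam a s) < e)"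
    by (rule eventually_conj)
  then obtain N where N: "m \<le> N" "\<And>s. Re s = \<sigma> \<Longrightarrow> dist (dir_psum lam a N s) (dir_sum lam a s) < e"
    using eventually_happens'[OF sequentially_bot] by force
  show "norm (a m) * exp (- (lam m * \<sigma>)) \<le> B + e"
  proof (rule dir_psum_coeff_bound[OF N(1)])
    fix t
    show "norm (dir_psum lam a N (Complex \<sigma> t)) \<le> B + e"
      using N(2)[of "Complex \<sigma> t"] bound[of "Complex \<sigma> t"]
        norm_triangle_sub[of "dir_psum lam a N (Complex \<sigma> t)" "dir_sum lam a (Complex \<sigma> t)"]
      by (simp add: dist_norm)
  qed
qed

end

section \<open>Gaussian averages along vertical lines\<close>

lemma prob_space_std_normal: "prob_space std_normal_distribution"
  using real_dist_normal_dist by (rule real_distribution.axioms)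

lemma measurable_vertical_line:
  fixes h :: "complex \<Rightarrow> complex"
  assumes "h holomorphic_on half_plane 0" "Re s > 0"
  shows "(\<lambda>u. h (s + \<i> * of_real (\<epsilon> * u))) \<in> borel_measurable std_normal_distribution"
proof -
  have "continuous_on UNIV (\<lambda>u. h (s + \<i> * of_real (\<epsilon> * u)))"
    by (rule continuous_on_compose2[OF holomorphic_on_imp_continuous_on[OF assms(1)]])
      (use assms in \<open>auto intro!: continuous_intros\<close>)
  then have "(\<lambda>u. h (s + \<i> * of_real (\<epsilon> * u))) \<in> borel_measurable borel"
    by (rule borel_measurable_continuous_onI)
  then show ?thesis by simp
qed

lemma integrable_vertical_line:
  fixes h :: "complex \<Rightarrow> complex"
  assumes "h holomorphic_on half_plane 0" "\<And>s. Re s > 0 \<Longrightarrow> norm (h s) \<le> F" "Re s > 0"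
  shows "integrable std_normal_distribution (\<lambda>u. h (s + \<i> * of_real (\<epsilon> * u)))"
proof -
  interpret prob_space std_normal_distribution by (rule prob_space_std_normal)
  show ?thesis
    by (rule integrable_const_bound[of _ F]) (use assms measurable_vertical_line in auto)
qed

text \<open>Differentiation under the integral sign: by Cauchy's inequality the derivative of a bounded
  function is bounded to the right of any vertical line inside the half-plane, so the difference
  quotients are dominated by a constant.\<close>

lemma holomorphic_gaussian_average:
  fixes f :: "complex \<Rightarrow> complex"
  assumes f: "f holomorphic_on half_plane 0" and bound: "\<And>s. Re s > 0 \<Longrightarrow> norm (f s) \<le> F"
  shows "(\<lambda>s. LINT u|std_normal_distribution. f (s + \<i> * of_real (\<epsilon> * u))) holomorphic_on half_plane 0"
    (is "?g holomorphic_on _")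
proof (rule holomorphic_onI)
  interpret prob_space std_normal_distribution by (rule prob_space_std_normal)
  have F: "F \<ge> 0" using order_trans[OF norm_ge_zero bound[of 1]] by simp
  have f': "(f has_field_derivative deriv f s) (at s)" if "Re s > 0" for s
    using holomorphic_derivI[OF f open_halfspace_Re_gt] that by simp
  fix z assume "z \<in> half_plane 0"
  then have z: "Re z > 0" by simp
  define r where "r = Re z / 3"
  have r: "r > 0" using z by (simp add: r_def)
  have deriv_bound: "norm (deriv f s) \<le> F / r" if s: "Re s > r" for s
  proof -
    have re: "Re x > 0" if "x \<in> cball s r" for x
      using that s complex_Re_le_cmod[of "s - x"] by (simp add: dist_norm)
    have "norm ((deriv ^^ 1) f s) \<le> fact 1 * F / r ^ 1"
    proof (rule Cauchy_inequality)
      show "f holomorphic_on ball s r"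
        by (rule holomorphic_on_subset[OF f]) (use re ball_subset_cball in blast)
      show "continuous_on (cball s r) f"
        by (rule holomorphic_on_imp_continuous_on, rule holomorphic_on_subset[OF f]) (use re in blast)
      show "norm (f x) \<le> F" if "norm (s - x) = r" for x
        using re[of x] that by (intro bound) (simp add: dist_norm)
    qed (rule r)
    then show ?thesis by simp
  qed
  let ?q = "\<lambda>y u. (f (y + \<i> * of_real (\<epsilon> * u)) - f (z + \<i> * of_real (\<epsilon> * u))) / (y - z)"
  note meas = measurable_vertical_line and int = integrable_vertical_line[OF f bound]
  have "(?g has_field_derivative (LINT u|std_normal_distribution. deriv f (z + \<i> * of_real (\<epsilon> * u)))) (at z)"
    unfolding has_field_derivative_iff tendsto_at_iff_sequentially
  proof (intro allI impI, unfold comp_def)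
    fix X assume X: "\<forall>i. X i \<in> UNIV - {z}" "X \<longlonglongrightarrow> z"
    obtain K where K: "\<And>n. n \<ge> K \<Longrightarrow> dist (X n) z < r"
      using X(2) r unfolding lim_sequentially by metis
    have ball: "Re (s + \<i> * of_real (\<epsilon> * u)) > r" if "s \<in> ball z r" for s u
      using that z complex_Re_le_cmod[of "z - s"] by (simp add: dist_norm r_def)
    have XK: "X (n + K) \<in> ball z r" "X (n + K) \<noteq> z" for n
      using K[of "n + K"] X(1) by (auto simp: dist_commute)
    have zb: "z \<in> ball z r" using r by simp
    have Re_pos: "Re s > 0" if "s \<in> ball z r" for s using ball[OF that, of 0] r by simp
    have "(\<lambda>n. LINT u|std_normal_distribution. ?q (X (n + K)) u)
        \<longlonglongrightarrow> (LINT u|std_normal_distribution. deriv f (z + \<i> * of_real (\<epsilon> * u)))"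
    proof (rule integral_dominated_convergence[where w = "\<lambda>_. F / r"])
      show "(\<lambda>u. deriv f (z + \<i> * of_real (\<epsilon> * u))) \<in> borel_measurable std_normal_distribution"
        by (intro meas holomorphic_deriv f open_halfspace_Re_gt z)
      show "(\<lambda>u. ?q (X (n + K)) u) \<in> borel_measurable std_normal_distribution" for n
        by (intro borel_measurable_divide borel_measurable_diff meas[OF f] borel_measurable_const
            z Re_pos XK)
      show "AE u in std_normal_distribution. (\<lambda>n. ?q (X (n + K)) u) \<longlonglongrightarrow> deriv f (z + \<i> * of_real (\<epsilon> * u))"
      proof (rule AE_I2)
        fix u
        let ?w = "\<i> * complex_of_real (\<epsilon> * u)"
        have "((\<lambda>y. f (y + ?w)) has_field_derivative deriv f (z + ?w)) (at z)"
          using f'[of "z + ?w"] z DERIV_at_within_shift[of f "deriv f (z + ?w)" ?w z UNIV]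
          by (simp add: add.commute)
        then have "(\<lambda>y. ?q y u) \<midarrow>z\<rightarrow> deriv f (z + ?w)"
          unfolding has_field_derivative_iff .
        then have "(\<lambda>n. ?q (X n) u) \<longlonglongrightarrow> deriv f (z + ?w)"
          unfolding tendsto_at_iff_sequentially comp_def using X by blast
        then show "(\<lambda>n. ?q (X (n + K)) u) \<longlonglongrightarrow> deriv f (z + ?w)" by (rule LIMSEQ_ignore_initial_segment)
      qed
      show "AE u in std_normal_distribution. norm (?q (X (n + K)) u) \<le> F / r" for n
      proof (rule AE_I2)
        fix u
        let ?w = "\<i> * complex_of_real (\<epsilon> * u)"
        let ?S = "(\<lambda>s. s + ?w) ` ball z r"
        have "norm (f (X (n + K) + ?w) - f (z + ?w)) \<le> F / r * norm (X (n + K) + ?w - (z + ?w))"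
        proof (rule field_differentiable_bound)
          show "convex ?S" using convex_translation[of "ball z r" ?w] by (simp add: add.commute image_def)
          fix x assume "x \<in> ?S"
          then have x: "Re x > r" using ball[of _ u] by force
          show "(f has_field_derivative deriv f x) (at x within ?S)"
            using f'[of x] x r by (simp add: has_field_derivative_at_within)
          show "norm (deriv f x) \<le> F / r" by (rule deriv_bound[OF x])
        qed (use XK zb in auto)
        then show "norm (?q (X (n + K)) u) \<le> F / r"
          using XK[of n] by (simp add: norm_divide divide_le_eq)
      qed
    qed simp
    then have "(\<lambda>n. (?g (X (n + K)) - ?g z) / (X (n + K) - z))
        \<longlonglongrightarrow> (LINT u|std_normal_distribution. deriv f (z + \<i> * of_real (\<epsilon> * u)))"
      using int Re_pos XK zb by (simp add: Bochner_Integration.integral_diff z)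
    then show "(\<lambda>n. (?g (X n) - ?g z) / (X n - z))
        \<longlonglongrightarrow> (LINT u|std_normal_distribution. deriv f (z + \<i> * of_real (\<epsilon> * u)))"
      by (rule LIMSEQ_offset)
  qed
  then show "?g field_differentiable (at z within half_plane 0)"
    using field_differentiable_at_within field_differentiable_def by blast
qed

definition gaussian_damping :: "(nat \<Rightarrow> real) \<Rightarrow> real \<Rightarrow> (nat \<Rightarrow> complex) \<Rightarrow> nat \<Rightarrow> complex" where
  "gaussian_damping lam \<epsilon> a n = a n * of_real (exp (- ((\<epsilon> * lam n)\<^sup>2 / 2)))"

text \<open>The damping factors are the values of the characteristic function of the normal
  distribution.\<close>

lemma gaussian_average_dir_psum:
  "(LINT u|std_normal_distribution. dir_psum lam a N (s + \<i> * of_real (\<epsilon> * u)))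
     = dir_psum lam (gaussian_damping lam \<epsilon> a) N s"
proof -
  interpret prob_space std_normal_distribution by (rule prob_space_std_normal)
  have eq: "dir_term lam a (s + \<i> * of_real (\<epsilon> * u)) n = dir_term lam a s n * iexp (- (\<epsilon> * lam n) * u)" for u n
    by (simp add: dir_term_add algebra_simps)
  have int: "integrable std_normal_distribution (\<lambda>u. iexp (t * u))" for t
    by (rule integrable_const_bound[of _ 1]) auto
  have "(LINT u|std_normal_distribution. iexp (- (\<epsilon> * lam n) * u)) = of_real (exp (- ((\<epsilon> * lam n)\<^sup>2 / 2)))" for n
    using fun_cong[OF char_std_normal_distribution, of "- (\<epsilon> * lam n)"] by (simp add: char_def)
  then have "(LINT u|std_normal_distribution. dir_term lam a (s + \<i> * of_real (\<epsilon> * u)) n)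
      = dir_term lam (gaussian_damping lam \<epsilon> a) s n" for n
    unfolding eq by (simp only: Bochner_Integration.integral_mult_right_zero) (simp add: dir_term_def gaussian_damping_def)
  moreover have "integrable std_normal_distribution (\<lambda>u. dir_term lam a (s + \<i> * of_real (\<epsilon> * u)) n)" for n
    unfolding eq by (intro integrable_mult_right int)
  ultimately show ?thesis by (simp add: Bochner_Integration.integral_sum)
qed

text \<open>Abel's test with a factor that decreases only from some index on, as needed for
  \<open>exp (T \<lambda>\<^sub>n - (\<epsilon> \<lambda>\<^sub>n)\<^sup>2 / 2)\<close>.\<close>

lemma summable_mult_decreasing:
  fixes c :: "nat \<Rightarrow> complex" and v :: "nat \<Rightarrow> real"
  assumes c: "summable c" and dec: "\<And>n. n \<ge> K \<Longrightarrow> v (Suc n) \<le> v n" and pos: "\<And>n. v n \<ge> 0"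
  shows "summable (\<lambda>n. c n * of_real (v n))"
  unfolding summable_Cauchy
proof (intro allI impI)
  fix e :: real assume e: "e > 0"
  define \<epsilon> where "\<epsilon> = e / (v K + 1)"
  have vK: "v K + 1 > 0" using pos[of K] by simp
  have "\<epsilon> > 0" using e vK by (simp add: \<epsilon>_def)
  then obtain M where M: "\<And>m n. m \<ge> M \<Longrightarrow> norm (sum c {m..<n}) < \<epsilon>"
    using c unfolding summable_Cauchy by meson
  have "norm (\<Sum>i=m..<n. c i * of_real (v i)) < e" if m: "m \<ge> max M K" for m n
  proof (cases "m < n")
    case True
    then obtain n' where n: "n = Suc n'" "m \<le> n'" by (cases n) auto
    have vm: "v m \<le> v K"
      using m lift_Suc_antimono_le[of "\<lambda>i. v (i + K)" 0 "m - K"] dec by simp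
    have "norm (complex_of_real (v i) - of_real (v (Suc i))) = v i - v (Suc i)" if "i \<ge> m" for i
      using dec[of i] that m by (simp add: norm_of_real flip: of_real_diff)
    then have "(\<Sum>i=m..<n'. norm (complex_of_real (v i) - of_real (v (Suc i)))) = (\<Sum>i=m..<n'. v i - v (Suc i))"
      by (intro sum.cong) auto
    also have "\<dots> = v m - v n'"
      using sum_Suc_diff'[OF n(2), of "\<lambda>i. - v i"] by simp
    finally have var: "(\<Sum>i=m..<n'. norm (complex_of_real (v i) - of_real (v (Suc i)))) = v m - v n'" .
    have "norm (\<Sum>i=m..k. c i) \<le> \<epsilon>" for k
      using M[of m "Suc k"] m unfolding atLeastLessThanSuc_atLeastAtMost by simp
    then have "norm (\<Sum>i=m..n'. c i * of_real (v i)) \<le> \<epsilon> * v m"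
      using var pos[of n'] by (intro abel_bound n(2)) auto
    also have "\<dots> < e"
    proof -
      have "\<epsilon> * v m < \<epsilon> * (v K + 1)" using vm \<open>\<epsilon> > 0\<close> by simp
      also have "\<dots> = e" using vK by (simp add: \<epsilon>_def)
      finally show ?thesis .
    qed
    finally show ?thesis by (simp add: n atLeastLessThanSuc_atLeastAtMost)
  qed (use e in auto)
  then show "\<exists>N. \<forall>m\<ge>N. \<forall>n. norm (\<Sum>i=m..<n. c i * of_real (v i)) < e" by blast
qed

lemma gaussian_damping_tendsto:
  "(\<lambda>m. dir_psum lam (gaussian_damping lam (inverse (real (Suc m))) a) N s) \<longlonglongrightarrow> dir_psum lam a N s"
proof -
  have "(\<lambda>m. dir_psum lam (gaussian_damping lam (inverse (real (Suc m))) a) N s)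
    \<longlonglongrightarrow> (\<Sum>n\<le>N. a n * of_real (exp (- ((0 * lam n)\<^sup>2 / 2))) * exp (- (of_real (lam n) * s)))"
    unfolding dir_term_def gaussian_damping_def
    by (intro tendsto_intros LIMSEQ_inverse_real_of_nat) simp
  then show ?thesis by (simp add: dir_term_def)
qed

context
  fixes lam :: "nat \<Rightarrow> real"
  assumes freq: "frequency lam"
begin

lemma abscissa_conv_le:
  assumes "summable (dir_term lam a s0)"
  shows "abscissa_conv lam a \<le> ereal (Re s0)"
  unfolding abscissa_conv_def
  by (rule Inf_lower) (use dir_summable_right[OF freq assms] in auto)

lemma summable_gaussian_damping:
  assumes a: "summable (dir_term lam a s0)" and \<epsilon>: "\<epsilon> > 0"
  shows "summable (dir_term lam (gaussian_damping lam \<epsilon> a) s)"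
proof -
  \<comment> \<open>The damped series is compared with the original one at distance \<open>T\<close> to the left of \<open>s0\<close>;
    the factor \<open>v\<close> decreases as soon as \<open>lam n\<close> passes the vertex of its exponent.\<close>
  define T where "T = Re s0 - Re s + 1"
  define v where "v n = exp (lam n * T - (\<epsilon> * lam n)\<^sup>2 / 2)" for n
  obtain K where K: "\<And>n. n \<ge> K \<Longrightarrow> lam n \<ge> T / \<epsilon>\<^sup>2"
    using lam_at_top[OF freq] unfolding filterlim_at_top eventually_sequentially by blast
  have "v (Suc n) \<le> v n" if "n \<ge> K" for n
  proof -
    have "0 \<le> (lam (Suc n) - lam n) * (\<epsilon>\<^sup>2 * (lam n + lam (Suc n)) / 2 - T)"
    proof (intro mult_nonneg_nonneg)
      show "0 \<le> lam (Suc n) - lam n" using lam_mono[OF freq, of n "Suc n"] by simp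
      have "T \<le> \<epsilon>\<^sup>2 * lam n" "T \<le> \<epsilon>\<^sup>2 * lam (Suc n)"
        using K[of n] K[of "Suc n"] that \<epsilon> by (simp_all add: divide_le_eq mult.commute)
      then show "0 \<le> \<epsilon>\<^sup>2 * (lam n + lam (Suc n)) / 2 - T" by (simp add: algebra_simps)
    qed
    then have "lam (Suc n) * T - (\<epsilon> * lam (Suc n))\<^sup>2 / 2 \<le> lam n * T - (\<epsilon> * lam n)\<^sup>2 / 2"
      by (simp add: power2_eq_square algebra_simps diff_divide_distrib)
    then show ?thesis by (simp add: v_def)
  qed
  then have "summable (\<lambda>n. dir_term lam a s0 n * of_real (v n))"
    by (intro summable_mult_decreasing[OF a]) (auto simp: v_def)
  also have "(\<lambda>n. dir_term lam a s0 n * of_real (v n)) =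
      dir_term lam (gaussian_damping lam \<epsilon> a) (s0 + of_real (- T))"
  proof
    fix n
    have "v n = exp (- ((\<epsilon> * lam n)\<^sup>2 / 2)) * exp (lam n * T)"
      unfolding v_def exp_add[symmetric] by simp
    moreover have "complex_of_real (exp (lam n * T)) = exp (- (complex_of_real (lam n) * of_real (- T)))"
      unfolding exp_of_real[symmetric] by simp
    ultimately show "dir_term lam a s0 n * of_real (v n) =
        dir_term lam (gaussian_damping lam \<epsilon> a) (s0 + of_real (- T)) n"
      unfolding dir_term_add by (simp add: dir_term_def gaussian_damping_def)
  qed
  finally show ?thesis
    by (rule dir_summable_right[OF freq]) (simp add: T_def)
qed

text \<open>Far to the right, the partial sums on a vertical line grow at most linearly, so they may be
  integrated term by term against the Gaussian, which identifies the average of \<open>f\<close> with the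
  damped series. The identity theorem carries this over to the whole half-plane, and an average of
  \<open>f\<close> is bounded by any bound of \<open>f\<close>.\<close>

lemma norm_gaussian_damping_le:
  assumes a: "summable (dir_term lam a s0)" and \<epsilon>: "\<epsilon> > 0"
    and f: "f holomorphic_on half_plane 0" and bound: "\<And>s. Re s > 0 \<Longrightarrow> norm (f s) \<le> F"
    and eq: "\<And>s. Re s > 0 \<Longrightarrow> Re s > Re s0 \<Longrightarrow> f s = dir_sum lam a s"
    and s: "Re s > 0"
  shows "norm (dir_sum lam (gaussian_damping lam \<epsilon> a) s) \<le> F"
proof -
  interpret prob_space std_normal_distribution by (rule prob_space_std_normal)
  let ?M = "std_normal_distribution"
  define g where "g s = (LINT u|?M. f (s + \<i> * of_real (\<epsilon> * u)))" for s
  obtain B where B: "\<And>N. norm (dir_psum lam a N s0) \<le> B"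
    using convergent_imp_Bseq[OF convergentI[OF dir_psum_tendsto[OF a]]] unfolding Bseq_def by blast
  have "g s = dir_sum lam (gaussian_damping lam \<epsilon> a) s" if s: "Re s > max 0 (Re s0)" for s
  proof (rule LIMSEQ_unique)
    show "(\<lambda>N. dir_psum lam (gaussian_damping lam \<epsilon> a) N s) \<longlonglongrightarrow> dir_sum lam (gaussian_damping lam \<epsilon> a) s"
      by (intro dir_psum_tendsto summable_gaussian_damping[OF a \<epsilon>])
    have "(\<lambda>N. LINT u|?M. dir_psum lam a N (s + \<i> * of_real (\<epsilon> * u))) \<longlonglongrightarrow> g s"
      unfolding g_def
    proof (rule integral_dominated_convergence[where
          w = "\<lambda>u. B / (Re s - Re s0) * norm (s - s0) + B / (Re s - Re s0) * \<epsilon> * \<bar>u ^ 1\<bar>"])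
      show "(\<lambda>u. f (s + \<i> * of_real (\<epsilon> * u))) \<in> borel_measurable ?M"
        using measurable_vertical_line[OF f] s by simp
      show "(\<lambda>u. dir_psum lam a N (s + \<i> * of_real (\<epsilon> * u))) \<in> borel_measurable ?M" for N
        using measurable_vertical_line[OF holomorphic_dir_psum] s by simp
      show "integrable ?M (\<lambda>u. B / (Re s - Re s0) * norm (s - s0) + B / (Re s - Re s0) * \<epsilon> * \<bar>u ^ 1\<bar>)"
        by (intro Bochner_Integration.integrable_add integrable_const integrable_mult_right
            integrable_abs integrable_std_normal_distribution_moment)
      show "AE u in ?M. (\<lambda>N. dir_psum lam a N (s + \<i> * of_real (\<epsilon> * u))) \<longlonglongrightarrow> f (s + \<i> * of_real (\<epsilon> * u))"
      proof (rule AE_I2)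
        fix u
        have "summable (dir_term lam a (s + \<i> * of_real (\<epsilon> * u)))"
          using s by (intro dir_summable_right[OF freq a]) simp
        then show "(\<lambda>N. dir_psum lam a N (s + \<i> * of_real (\<epsilon> * u))) \<longlonglongrightarrow> f (s + \<i> * of_real (\<epsilon> * u))"
          using s by (subst eq) (simp_all add: dir_psum_tendsto)
      qed
      show "AE u in ?M. norm (dir_psum lam a N (s + \<i> * of_real (\<epsilon> * u)))
        \<le> B / (Re s - Re s0) * norm (s - s0) + B / (Re s - Re s0) * \<epsilon> * \<bar>u ^ 1\<bar>" for N
      proof (rule AE_I2)
        fix u
        let ?w = "\<i> * complex_of_real (\<epsilon> * u)"
        have "norm (dir_psum lam a N (s + ?w)) \<le> B * (norm (s + ?w - s0) / (Re (s + ?w) - Re s0))"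
          using s by (intro dir_psum_bound[OF freq B]) simp
        also have "\<dots> = B / (Re s - Re s0) * norm ((s - s0) + ?w)" by (simp add: algebra_simps)
        also have "\<dots> \<le> B / (Re s - Re s0) * (norm (s - s0) + norm ?w)"
          using s order_trans[OF norm_ge_zero B]
          by (intro mult_left_mono norm_triangle_ineq divide_nonneg_pos) auto
        also have "\<dots> = B / (Re s - Re s0) * norm (s - s0) + B / (Re s - Re s0) * \<epsilon> * \<bar>u ^ 1\<bar>"
          using \<epsilon> by (simp add: norm_mult abs_mult algebra_simps)
        finally show "norm (dir_psum lam a N (s + ?w))
          \<le> B / (Re s - Re s0) * norm (s - s0) + B / (Re s - Re s0) * \<epsilon> * \<bar>u ^ 1\<bar>" .
      qed
    qed
    then show "(\<lambda>N. dir_psum lam (gaussian_damping lam \<epsilon> a) N s) \<longlonglongrightarrow> g s"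
      unfolding gaussian_average_dir_psum .
  qed
  note agree = this
  have "g s = dir_sum lam (gaussian_damping lam \<epsilon> a) s"
  proof (rule dir_sum_eq_extension[OF freq])
    show "g holomorphic_on half_plane 0"
      unfolding g_def by (rule holomorphic_gaussian_average[OF f bound])
    show "g s = dir_sum lam (gaussian_damping lam \<epsilon> a) s" if "Re s > max 0 (Re s0)" for s
      by (rule agree[OF that])
    show "summable (dir_term lam (gaussian_damping lam \<epsilon> a) (of_real \<sigma>'))" for \<sigma>'
      by (rule summable_gaussian_damping[OF a \<epsilon>])
  qed (rule s)+
  moreover have "norm (g s) \<le> F"
  proof -
    note int = integrable_vertical_line[OF f bound s, of \<epsilon>]
    have "norm (g s) \<le> (LINT u|?M. norm (f (s + \<i> * of_real (\<epsilon> * u))))"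
      unfolding g_def by (rule integral_norm_bound)
    also have "\<dots> \<le> F"
      by (rule integral_le_const) (use int s bound in auto)
    finally show ?thesis .
  qed
  ultimately show ?thesis by simp
qed

section \<open>The partial sum estimate implies Bohr's theorem\<close>

lemma uniformly_convergent_of_bounded_psum:
  assumes bound: "\<And>N s. Re s > \<sigma> \<Longrightarrow> norm (dir_psum lam a N s) \<le> B" and \<delta>: "\<delta> > 0"
  shows "uniformly_convergent_on (half_plane (\<sigma> + \<delta>)) (dir_psum lam a)"
proof (rule Cauchy_uniformly_convergent, rule uniformly_Cauchy_onI')
  fix e :: real assume e: "e > 0"
  have "(\<lambda>m. 2 * B * exp (- (lam (Suc m) * \<delta>))) \<longlonglongrightarrow> 2 * B * 0"
  proof (intro tendsto_mult_left filterlim_compose[OF exp_at_bot] filterlim_compose[OF filterlim_uminus_at_bot_at_top])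
    have "filterlim (\<lambda>m. lam (Suc m)) at_top sequentially"
      using lam_at_top[OF freq] filterlim_Suc by (rule filterlim_compose)
    then show "filterlim (\<lambda>m. lam (Suc m) * \<delta>) at_top sequentially"
      using \<delta> by (intro filterlim_at_top_mult_tendsto_pos[OF tendsto_const])
  qed
  then have "\<forall>\<^sub>F m in sequentially. 2 * B * exp (- (lam (Suc m) * \<delta>)) < e"
    by (rule order_tendstoD(2)) (use e in simp)
  then obtain M where M: "\<And>m. m \<ge> M \<Longrightarrow> 2 * B * exp (- (lam (Suc m) * \<delta>)) < e"
    unfolding eventually_sequentially by blast
  have "dist (dir_psum lam a m s) (dir_psum lam a n s) < e"
    if s: "s \<in> half_plane (\<sigma> + \<delta>)" and mn: "m \<ge> M" "n > m" for s m n
  proof -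
    let ?s = "s - complex_of_real \<delta>"
    have split: "dir_psum lam a k z = dir_psum lam a m z + (\<Sum>i=Suc m..k. dir_term lam a z i)"
      if "k > m" for k z
      using sum_up_index_split[of "dir_term lam a z" m "k - m"] that by simp
    have "norm (\<Sum>i=Suc m..n. dir_term lam a (?s + of_real \<delta>) i)
      \<le> 2 * B * (norm (complex_of_real \<delta>) / Re (complex_of_real \<delta>) * exp (- (lam (Suc m) * Re (complex_of_real \<delta>))))"
    proof (rule dir_block_bound[OF freq])
      fix k assume "Suc m \<le> k"
      then have "(\<Sum>i=Suc m..k. dir_term lam a ?s i) = dir_psum lam a k ?s - dir_psum lam a m ?s"
        using split[of k ?s] by simp
      also have "norm \<dots> \<le> B + B"
        using s by (intro order_trans[OF norm_triangle_ineq4] add_mono bound) auto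
      finally show "norm (\<Sum>i=Suc m..k. dir_term lam a ?s i) \<le> 2 * B" by simp
    qed (use mn \<delta> in auto)
    also have "\<dots> < e" using M[OF mn(1)] \<delta> by simp
    finally show ?thesis using split[OF mn(2), of s] by (simp add: dist_norm)
  qed
  then show "\<exists>M. \<forall>x\<in>half_plane (\<sigma> + \<delta>). \<forall>m\<ge>M. \<forall>n>m. dist (dir_psum lam a m x) (dir_psum lam a n x) < e"
    by blast
qed

text \<open>The damped series lie in \<open>D_inf_plus lam\<close> even when the given one does not, and the constants
  \<open>C\<close> and \<open>F\<close> do not depend on the amount of damping.\<close>

lemma bohr_theorem_if_partial_sum_bound:
  assumes ii: "\<forall>k\<ge>1. \<exists>l>k. \<exists>C::real. C > 0 \<and> (\<forall>a\<in>D_inf_plus lam.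
      (SUP N. dir_norm lam k (dir_partial N a)) \<le> ereal C * dir_norm lam l a)"
  shows "bohr_theorem_holds lam"
  unfolding bohr_theorem_holds_def
proof
  fix a assume "a \<in> D_inf_ext lam"
  then obtain s0 f F where a: "summable (dir_term lam a s0)" and f: "f holomorphic_on half_plane 0"
    and bound: "\<And>s. Re s > 0 \<Longrightarrow> norm (f s) \<le> F"
    and eq: "\<And>s. Re s > 0 \<Longrightarrow> abscissa_conv lam a < ereal (Re s) \<Longrightarrow> f s = dir_sum lam a s"
    unfolding D_inf_ext_def bounded_iff by auto
  have eq': "f s = dir_sum lam a s" if "Re s > 0" "Re s > Re s0" for s
    using that abscissa_conv_le[OF a] by (intro eq) (auto intro: le_less_trans)
  show "abscissa_unif lam a \<le> 0"
  proof (rule abscissa_unif_nonpos)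
    fix \<sigma> :: real assume \<sigma>: "\<sigma> > 0"
    then obtain n where n: "inverse (real (Suc n)) < \<sigma>" using reals_Archimedean by blast
    define k where "k = Suc n"
    have k: "k \<ge> 1" "1 / real k < \<sigma>" using n by (auto simp: k_def divide_inverse)
    from ii k(1) obtain l C where l: "l > k" "C > 0" and C: "\<And>b. b \<in> D_inf_plus lam \<Longrightarrow>
        (SUP N. dir_norm lam k (dir_partial N b)) \<le> ereal C * dir_norm lam l b" by blast
    have "norm (dir_psum lam a N s) \<le> C * F" if s: "Re s > 1 / real k" for N s
    proof (rule Lim_norm_ubound[OF sequentially_bot gaussian_damping_tendsto], rule always_eventually, rule allI)
      fix m
      define b where "b = gaussian_damping lam (inverse (real (Suc m))) a"
      have b: "norm (dir_sum lam b s) \<le> F" if "Re s > 0" for s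
        unfolding b_def using that by (intro norm_gaussian_damping_le[OF a _ f bound eq']) auto
      have "b \<in> D_inf_plus lam"
        using b summable_gaussian_damping[OF a] unfolding D_inf_plus_def bounded_iff
        by (auto simp: b_def intro!: exI[of _ F])
      from C[OF this] have "(SUP N. dir_norm lam k (dir_partial N b)) \<le> ereal C * dir_norm lam l b" .
      moreover have "dir_norm lam l b \<le> ereal F"
        unfolding dir_norm_le_iff
      proof (intro allI impI b)
        fix s assume "Re s > 1 / real l"
        moreover have "1 / real l > 0" using l(1) by simp
        ultimately show "Re s > 0" by linarith
      qed
      then have "ereal C * dir_norm lam l b \<le> ereal (C * F)"
        using l(2) ereal_mult_left_mono[of "dir_norm lam l b" "ereal F" "ereal C"] by simp
      moreover have "dir_norm lam k (dir_partial N b) \<le> (SUP N. dir_norm lam k (dir_partial N b))"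
        by (rule SUP_upper) simp
      ultimately have "dir_norm lam k (dir_partial N b) \<le> ereal (C * F)" by order
      then show "norm (dir_psum lam b N s) \<le> C * F" using s unfolding dir_norm_le_iff by simp
    qed
    from uniformly_convergent_of_bounded_psum[where \<sigma> = "1 / real k" and \<delta> = "\<sigma> - 1 / real k", OF this] k(2)
    show "uniformly_convergent_on (half_plane \<sigma>) (dir_psum lam a)" by simp
  qed
qed

end

section \<open>Bohr's theorem implies the partial sum estimate\<close>

lemma uniformly_bounded_dir_psum:
  assumes a: "\<And>n. norm (a n) \<le> B" and lam: "\<And>n. lam n \<ge> 0" and "\<sigma> \<ge> 0"
    and unif: "uniformly_convergent_on (half_plane \<sigma>) (dir_psum lam a)"
  shows "\<exists>K. \<forall>N s. Re s > \<sigma> \<longrightarrow> norm (dir_psum lam a N s) \<le> K"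
proof -
  have B: "B \<ge> 0" using order_trans[OF norm_ge_zero a[of 0]] .
  obtain M where M: "\<And>s m n. s \<in> half_plane \<sigma> \<Longrightarrow> m \<ge> M \<Longrightarrow> n \<ge> M \<Longrightarrow>
      dist (dir_psum lam a m s) (dir_psum lam a n s) < 1"
    using uniformly_convergent_Cauchy[OF unif] unfolding uniformly_Cauchy_on_def
    by (meson zero_less_one)
  have small: "norm (dir_psum lam a N s) \<le> real (Suc M) * B" if "N \<le> M" "Re s > \<sigma>" for N s
  proof -
    have "norm (dir_psum lam a N s) \<le> real (Suc N) * B"
      using a lam that assms(3) by (intro norm_dir_psum_le[where \<sigma> = 0]) auto
    also have "\<dots> \<le> real (Suc M) * B" using that B by (intro mult_right_mono) auto
    finally show ?thesis .
  qed
  have "norm (dir_psum lam a N s) \<le> 1 + real (Suc M) * B" if s: "Re s > \<sigma>" for N s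
  proof (cases "N \<le> M")
    case True
    with small[OF True s] show ?thesis by simp
  next
    case False
    then have "dist (dir_psum lam a N s) (dir_psum lam a M s) < 1" using M[of s N M] s by simp
    then show ?thesis
      using small[of M s] s norm_triangle_sub[of "dir_psum lam a N s" "dir_psum lam a M s"]
      unfolding dist_norm by linarith
  qed
  then show ?thesis by blast
qed

definition dir_shift :: "(nat \<Rightarrow> real) \<Rightarrow> real \<Rightarrow> (nat \<Rightarrow> complex) \<Rightarrow> nat \<Rightarrow> complex" where
  "dir_shift lam \<tau> a n = a n * of_real (exp (- (lam n * \<tau>)))"

lemma dir_term_shift: "dir_term lam (dir_shift lam \<tau> a) s = dir_term lam a (s + of_real \<tau>)"
  unfolding dir_term_add by (simp add: fun_eq_iff dir_term_def dir_shift_def exp_of_real[symmetric])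

lemma dir_sum_shift: "dir_sum lam (dir_shift lam \<tau> a) s = dir_sum lam a (s + of_real \<tau>)"
  by (simp add: dir_sum_def dir_term_shift)

definition bounded_dir_series :: "(nat \<Rightarrow> real) \<Rightarrow> (nat \<Rightarrow> complex) \<Rightarrow> real \<Rightarrow> bool" where
  "bounded_dir_series lam a B \<longleftrightarrow>
     (\<forall>s. Re s > 0 \<longrightarrow> summable (dir_term lam a s) \<and> norm (dir_sum lam a s) \<le> B)"

lemma bounded_dir_series_D_inf_plus: "bounded_dir_series lam a B \<Longrightarrow> a \<in> D_inf_plus lam"
  unfolding bounded_dir_series_def D_inf_plus_def bounded_iff by (auto intro!: exI[of _ B])

lemma dir_term_scale: "dir_term lam (\<lambda>n. c * a n) s = (\<lambda>n. c * dir_term lam a s n)"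
  by (simp add: dir_term_def fun_eq_iff mult.assoc)

lemma bounded_dir_series_scale:
  assumes "bounded_dir_series lam a B" "norm c * B \<le> B'"
  shows "bounded_dir_series lam (\<lambda>n. c * a n) B'"
proof -
  have "norm (c * dir_sum lam a s) \<le> B'" if "Re s > 0" for s
    using assms that mult_left_mono[of "norm (dir_sum lam a s)" B "norm c"]
    unfolding bounded_dir_series_def norm_mult by force
  then show ?thesis
    using assms(1) unfolding bounded_dir_series_def dir_term_scale dir_sum_def
    by (auto simp: summable_mult suminf_mult)
qed

text \<open>The arithmetic of the gliding hump: the terms before the \<open>j\<close>-th add up to at most
  \<open>8 ^ j / 7\<close>, the later ones to at most 1.\<close>

lemma norm_gt_of_dominant_term:
  fixes t :: "nat \<Rightarrow> complex"
  assumes less: "\<And>i. i < j \<Longrightarrow> norm (t i) \<le> 8 ^ i" and eq: "norm (t j) > 8 ^ j / 2"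
    and greater: "\<And>i. i > j \<Longrightarrow> norm (t i) \<le> (1/2) ^ i"
  shows "norm (\<Sum>i. t i) > 8 ^ j / 4 - 1"
proof -
  have tail: "(\<lambda>i. (1/2) ^ (i + Suc j)) sums ((1/2::real) ^ j)"
    using sums_mult2[OF geometric_sums[of "1/2::real"], of "(1/2) ^ Suc j"] by (simp add: power_add)
  have g: "norm (t (i + Suc j)) \<le> (1/2) ^ (i + Suc j)" for i by (rule greater) simp
  have sm: "summable (\<lambda>i. norm (t (i + Suc j)))"
    by (rule summable_comparison_test'[OF sums_summable[OF tail]]) (simp only: real_norm_def abs_norm_cancel g)
  then have "summable (\<lambda>i. t (i + Suc j))" by (rule summable_norm_cancel)
  then have st: "summable t" by (simp only: summable_iff_shift)
  have "norm (\<Sum>i. t (i + Suc j)) \<le> (1/2) ^ j"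
    using norm_suminf_le[OF g sums_summable[OF tail]] unfolding sums_unique[OF tail, symmetric] .
  moreover have "(1/2) ^ j \<le> (1::real)" by (rule power_le_one) auto
  moreover have "norm (\<Sum>i<j. t i) \<le> (8 ^ j - 1) / 7"
  proof -
    have "norm (\<Sum>i<j. t i) \<le> (\<Sum>i<j. 8 ^ i)" using less by (intro sum_norm_le) simp
    also have "\<dots> = (8 ^ j - 1) / (7::real)" using geometric_sum[of "8::real" j] by simp
    finally show ?thesis .
  qed
  moreover have "(\<Sum>i. t i) = (\<Sum>i. t (i + Suc j)) + ((\<Sum>i<j. t i) + t j)"
    using suminf_split_initial_segment[OF st, of "Suc j"] by simp
  then have "norm (t j) \<le> norm (\<Sum>i. t i) + norm (\<Sum>i. t (i + Suc j)) + norm (\<Sum>i<j. t i)"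
    using norm_triangle_ineq4[of "(\<Sum>i. t i) - (\<Sum>i. t (i + Suc j))" "\<Sum>i<j. t i"]
      norm_triangle_ineq4[of "\<Sum>i. t i" "\<Sum>i. t (i + Suc j)"] by simp
  moreover have "(0::real) < 8 ^ j" by simp
  moreover have "E / 4 - 1 < X"
    if "A \<le> h" "h \<le> 1" "B \<le> (E - 1) / 7" "T \<le> X + A + B" "0 < E" "E / 2 < T"
    for A B E T X h :: real
    using that by (simp add: field_simps)
  ultimately show ?thesis using eq by blast
qed

context
  fixes lam :: "nat \<Rightarrow> real"
  assumes freq: "frequency lam"
begin

text \<open>A series in \<open>D_inf_plus lam\<close> is bounded only on smaller half-planes; moved to the right by
  \<open>\<sigma> / 2\<close> it becomes bounded on the full one, and Bohr's theorem applies.\<close>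

lemma bohr_uniformly_convergent:
  assumes bohr: "bohr_theorem_holds lam" and a: "a \<in> D_inf_plus lam" and \<sigma>: "\<sigma> > 0"
  shows "uniformly_convergent_on (half_plane \<sigma>) (dir_psum lam a)"
proof -
  define \<tau> where "\<tau> = \<sigma> / 2"
  have \<tau>: "\<tau> > 0" using \<sigma> by (simp add: \<tau>_def)
  let ?b = "dir_shift lam \<tau> a"
  have sm: "summable (dir_term lam ?b s)" if "Re s > - \<tau>" for s
    using a that unfolding D_inf_plus_def by (simp add: dir_term_shift)
  have "?b \<in> D_inf_ext lam"
    unfolding D_inf_ext_def
  proof (intro CollectI conjI exI[of _ "dir_sum lam ?b"] ballI impI refl)
    show "\<exists>s. summable (dir_term lam ?b s)" using sm[of 0] \<tau> by auto
    show "dir_sum lam ?b holomorphic_on half_plane 0"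
      using sm \<tau> by (intro holomorphic_dir_sum[OF freq]) auto
    have "dir_sum lam ?b ` half_plane 0 \<subseteq> dir_sum lam a ` half_plane \<tau>"
      unfolding dir_sum_shift by (auto intro!: imageI)
    moreover have "bounded (dir_sum lam a ` half_plane \<tau>)" using a \<tau> unfolding D_inf_plus_def by blast
    ultimately show "bounded (dir_sum lam ?b ` half_plane 0)" by (rule bounded_subset[rotated])
  qed
  with bohr have "abscissa_unif lam ?b \<le> 0" unfolding bohr_theorem_holds_def by blast
  also have "\<dots> < ereal \<tau>" using \<tau> by simp
  finally obtain l where l: "uniform_limit (half_plane \<tau>) (dir_psum lam ?b) l sequentially"
    using abscissa_unif_lessD unfolding uniformly_convergent_on_def by blast
  have "uniform_limit (half_plane \<sigma>) (\<lambda>N s. dir_psum lam ?b N (s - of_real \<tau>)) (\<lambda>s. l (s - of_real \<tau>)) sequentially"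
    using l by (rule uniform_limit_compose') (auto simp: \<tau>_def)
  then show ?thesis unfolding dir_term_shift uniformly_convergent_on_def by auto
qed

lemma bohr_coeff_bound:
  assumes bohr: "bohr_theorem_holds lam" and a: "a \<in> D_inf_plus lam"
    and \<sigma>: "\<sigma> > 0" and bound: "\<And>s. Re s = \<sigma> \<Longrightarrow> norm (dir_sum lam a s) \<le> B"
  shows "norm (a m) * exp (- (lam m * \<sigma>)) \<le> B"
proof (rule dir_sum_coeff_bound[OF freq _ bound])
  have "uniformly_convergent_on (half_plane (\<sigma> / 2)) (dir_psum lam a)"
    by (rule bohr_uniformly_convergent[OF bohr a]) (use \<sigma> in simp)
  then have "uniformly_convergent_on {s. Re s = \<sigma>} (dir_psum lam a)"
    by (rule uniformly_convergent_on_subset) (use \<sigma> in auto)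
  then show "uniform_limit {s. Re s = \<sigma>} (dir_psum lam a) (dir_sum lam a) sequentially"
    by (rule uniformly_convergent_dir_psum)
qed

lemma bounded_dir_series_coeff:
  assumes bohr: "bohr_theorem_holds lam" and a: "bounded_dir_series lam a B"
  shows "norm (a m) \<le> B"
proof (rule tendsto_upperbound)
  show "((\<lambda>\<sigma>. norm (a m) * exp (- (lam m * \<sigma>))) \<longlongrightarrow> norm (a m)) (at_right 0)"
    by (auto intro!: tendsto_eq_intros)
  show "\<forall>\<^sub>F \<sigma> in at_right 0. norm (a m) * exp (- (lam m * \<sigma>)) \<le> B"
    unfolding eventually_at_right_field
    using bohr_coeff_bound[OF bohr bounded_dir_series_D_inf_plus[OF a]] a
    by (auto simp: bounded_dir_series_def intro!: exI[of _ 1])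
qed simp

text \<open>One hump. A series violating the estimate with a huge constant is scaled so that the supremum of
  its partial sums on \<open>Re s > \<delta>\<close> is exactly \<open>H\<close>. Its limit function is then so small that the
  coefficient bound also makes the first \<open>M + 1\<close> partial sums at most \<open>\<epsilon>\<close>.\<close>

lemma unbounded_partial_sums_block:
  assumes bohr: "bohr_theorem_holds lam" and \<delta>: "\<delta> > 0"
    and unbounded: "\<And>C. C > 0 \<Longrightarrow> \<exists>a B N s. bounded_dir_series lam a B \<and> Re s > \<delta> \<and>
      norm (dir_psum lam a N s) > C * B"
    and \<epsilon>: "\<epsilon> > 0" "\<epsilon> \<le> H"
  shows "\<exists>q N s. bounded_dir_series lam q \<epsilon> \<and> Re s > \<delta> \<and> norm (dir_psum lam q N s) > H / 2 \<and>
    (\<forall>n s. Re s > \<delta> \<longrightarrow> norm (dir_psum lam q n s) \<le> H) \<and>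
    (\<forall>n\<le>M. \<forall>s. Re s > 0 \<longrightarrow> norm (dir_psum lam q n s) \<le> \<epsilon>)"
proof -
  have H: "H > 0" using \<epsilon> by simp
  \<comment> \<open>Up to \<open>M\<close> there are \<open>Suc M\<close> coefficients, each bounded by the norm of the limit function.\<close>
  define C where "C = H * real (Suc M) / \<epsilon>"
  have "C > 0" using H \<epsilon> by (simp add: C_def)
  then obtain a B N0 s0 where a: "bounded_dir_series lam a B" and s0: "Re s0 > \<delta>"
    and large: "norm (dir_psum lam a N0 s0) > C * B"
    using unbounded by blast
  have coeff: "norm (a n) \<le> B" for n by (rule bounded_dir_series_coeff[OF bohr a])
  have B: "B \<ge> 0" using order_trans[OF norm_ge_zero coeff[of 0]] .
  obtain K where K: "\<And>N s. Re s > \<delta> \<Longrightarrow> norm (dir_psum lam a N s) \<le> K"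
    using uniformly_bounded_dir_psum[OF coeff lam_nonneg[OF freq] less_imp_le[OF \<delta>]
        bohr_uniformly_convergent[OF bohr bounded_dir_series_D_inf_plus[OF a] \<delta>]] by blast
  define A where "A = {norm (dir_psum lam a n s) |n s. Re s > \<delta>}"
  define \<Phi> where "\<Phi> = Sup A"
  have bdd: "bdd_above A" using K unfolding A_def bdd_above_def by blast
  have upper: "norm (dir_psum lam a n s) \<le> \<Phi>" if "Re s > \<delta>" for n s
    unfolding \<Phi>_def by (rule cSup_upper[OF _ bdd]) (use that in \<open>auto simp: A_def\<close>)
  have \<Phi>_gt: "\<Phi> > C * B" using large upper[OF s0, of N0] by linarith
  have \<Phi>: "\<Phi> > 0" using \<Phi>_gt B \<open>C > 0\<close> by (meson less_imp_le mult_nonneg_nonneg order_le_less_trans)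
  have "A \<noteq> {}" using s0 by (auto simp: A_def)
  then obtain N s where s: "Re s > \<delta>" "norm (dir_psum lam a N s) > \<Phi> / 2"
    using less_cSup_iff[OF _ bdd, of "\<Phi> / 2"] \<Phi> unfolding \<Phi>_def[symmetric] by (auto simp: A_def)
  define c where "c = H / \<Phi>"
  have c: "c > 0" using H \<Phi> by (simp add: c_def)
  let ?q = "\<lambda>n. complex_of_real c * a n"
  have cB: "real (Suc M) * (c * B) \<le> \<epsilon>"
    using \<Phi>_gt \<Phi> \<epsilon> H by (simp add: c_def C_def field_simps)
  have "c * B \<le> real (Suc M) * (c * B)"
    using B c mult_right_mono[of 1 "real (Suc M)" "c * B"] by simp
  with cB have cB': "c * B \<le> \<epsilon>" by linarith
  have psum: "dir_psum lam ?q n s = of_real c * dir_psum lam a n s" for n s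
    by (simp add: dir_term_scale sum_distrib_left)
  have npsum: "norm (dir_psum lam ?q n s) = c * norm (dir_psum lam a n s)" for n s
    unfolding psum norm_mult using c by simp
  show ?thesis
  proof (intro exI conjI allI impI)
    show "bounded_dir_series lam ?q \<epsilon>"
      using c cB' by (intro bounded_dir_series_scale[OF a]) simp
    show "Re s > \<delta>" by (rule s)
    show "norm (dir_psum lam ?q N s) > H / 2"
      using s(2) c \<Phi> unfolding npsum by (simp add: c_def field_simps)
    show "norm (dir_psum lam ?q n s) \<le> H" if "Re s > \<delta>" for n s
      using mult_left_mono[OF upper[OF that], of c n] c \<Phi> unfolding npsum by (simp add: c_def)
    show "norm (dir_psum lam ?q n s) \<le> \<epsilon>" if "n \<le> M" "Re s > 0" for n s
    proof -
      have "norm (dir_psum lam ?q n s) \<le> real (Suc n) * (c * B)"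
        using coeff c lam_nonneg[OF freq] that
        by (intro norm_dir_psum_le[where \<sigma> = 0]) (auto simp: norm_mult)
      also have "\<dots> \<le> real (Suc M) * (c * B)" using that B c by (intro mult_right_mono) auto
      finally show ?thesis using cB by linarith
    qed
  qed
qed

text \<open>This makes the sum of all humps converge somewhere: one unit further to the right, the
  terms after the index \<open>M\<close> gain the factor \<open>exp (- lam (Suc M))\<close>, which does not depend on the series.\<close>

lemma dir_psum_shift_small:
  assumes low: "\<And>n s. n \<le> M \<Longrightarrow> Re s > \<delta> \<Longrightarrow> norm (dir_psum lam q n s) \<le> \<epsilon>"
    and all: "\<And>n s. Re s > \<delta> \<Longrightarrow> norm (dir_psum lam q n s) \<le> H"
    and s: "Re s > \<delta> + 1"
  shows "norm (dir_psum lam q n s) \<le> \<epsilon> + 2 * H * exp (- lam (Suc M))"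
proof (cases "n \<le> M")
  case True
  have "0 \<le> H" using order_trans[OF norm_ge_zero all[of s]] s by simp
  then have "0 \<le> 2 * H * exp (- lam (Suc M))" by simp
  with low[OF True, of s] s show ?thesis by linarith
next
  case False
  have split: "dir_psum lam q k z = dir_psum lam q M z + (\<Sum>i=Suc M..k. dir_term lam q z i)"
    if "k > M" for k z
    using sum_up_index_split[of "dir_term lam q z" M "k - M"] that by simp
  have "norm (\<Sum>i=Suc M..n. dir_term lam q (s - 1 + 1) i)
    \<le> 2 * H * (norm (1::complex) / Re 1 * exp (- (lam (Suc M) * Re 1)))"
  proof (rule dir_block_bound[OF freq])
    fix k assume "Suc M \<le> k"
    then have "(\<Sum>i=Suc M..k. dir_term lam q (s - 1) i) = dir_psum lam q k (s - 1) - dir_psum lam q M (s - 1)"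
      using split[of k "s - 1"] by simp
    also have "norm \<dots> \<le> H + H"
      using s by (intro order_trans[OF norm_triangle_ineq4] add_mono all) auto
    finally show "norm (\<Sum>i=Suc M..k. dir_term lam q (s - 1) i) \<le> 2 * H" by simp
  qed (use False in auto)
  then have "norm (\<Sum>i=Suc M..n. dir_term lam q s i) \<le> 2 * H * exp (- lam (Suc M))" by simp
  with low[of M s] s False show ?thesis
    by (subst split) (auto intro: order_trans[OF norm_triangle_ineq] add_mono)
qed

text \<open>Each hump is chosen after the position \<open>N j\<close> of the previous one is known, so that it is
  negligible there.\<close>

lemma gliding_hump_sequence:
  assumes bohr: "bohr_theorem_holds lam" and \<delta>: "\<delta> > 0"
    and unbounded: "\<And>C. C > 0 \<Longrightarrow> \<exists>a B N s. bounded_dir_series lam a B \<and> Re s > \<delta> \<and>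
      norm (dir_psum lam a N s) > C * B"
  obtains q :: "nat \<Rightarrow> nat \<Rightarrow> complex" and z :: "nat \<Rightarrow> complex" and N :: "nat \<Rightarrow> nat" where
    "\<And>j. bounded_dir_series lam (q j) ((1/2) ^ j)"
    "\<And>j. Re (z j) > \<delta>" "\<And>j. norm (dir_psum lam (q j) (N j) (z j)) > 8 ^ j / 2"
    "\<And>j n s. Re s > \<delta> \<Longrightarrow> norm (dir_psum lam (q j) n s) \<le> 8 ^ j"
    "\<And>i j s. i < j \<Longrightarrow> Re s > 0 \<Longrightarrow> norm (dir_psum lam (q j) (N i) s) \<le> (1/2) ^ j"
    "\<And>j n s. Re s > \<delta> + 1 \<Longrightarrow> norm (dir_psum lam (q j) n s) \<le> 3 * (1/2) ^ j"
proof -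
  define P where "P j x \<longleftrightarrow> (case x of (q, N, z) \<Rightarrow> bounded_dir_series lam q ((1/2) ^ j) \<and> Re z > \<delta> \<and>
      norm (dir_psum lam q N z) > 8 ^ j / 2 \<and>
      (\<forall>n s. Re s > \<delta> \<longrightarrow> norm (dir_psum lam q n s) \<le> 8 ^ j) \<and>
      (\<forall>n s. Re s > \<delta> + 1 \<longrightarrow> norm (dir_psum lam q n s) \<le> 3 * (1/2) ^ j))"
    for j :: nat and x :: "(nat \<Rightarrow> complex) \<times> nat \<times> complex"
  define Q where "Q j x y \<longleftrightarrow> (case x of (q, N, z) \<Rightarrow> case y of (q', N', z') \<Rightarrow>
      N \<le> N' \<and> (\<forall>n\<le>N. \<forall>s. Re s > 0 \<longrightarrow> norm (dir_psum lam q' n s) \<le> (1/2) ^ Suc j))"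
    for j :: nat and x y :: "(nat \<Rightarrow> complex) \<times> nat \<times> complex"
  have step: "\<exists>q N z. P j (q, N, z) \<and> (\<forall>n\<le>N0. \<forall>s. Re s > 0 \<longrightarrow> norm (dir_psum lam q n s) \<le> (1/2) ^ j)"
    for j N0
  proof -
    \<comment> \<open>Beyond \<open>R\<close> the factor gained by a unit shift, at most \<open>(1/16) ^ j\<close>, outweighs the height
      \<open>8 ^ j\<close> of the hump.\<close>
    obtain R where R: "\<And>n. n \<ge> R \<Longrightarrow> lam n \<ge> real j * ln 16"
      using lam_at_top[OF freq] unfolding filterlim_at_top eventually_sequentially by blast
    define M where "M = max N0 R"
    have le: "(1/2) ^ j \<le> (8::real) ^ j" by (rule power_mono) auto
    obtain q N z where q: "bounded_dir_series lam q ((1/2) ^ j)" "Re z > \<delta>"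
      "norm (dir_psum lam q N z) > 8 ^ j / 2"
      "\<And>n s. Re s > \<delta> \<Longrightarrow> norm (dir_psum lam q n s) \<le> 8 ^ j"
      "\<And>n s. n \<le> M \<Longrightarrow> Re s > 0 \<Longrightarrow> norm (dir_psum lam q n s) \<le> (1/2) ^ j"
      using unbounded_partial_sums_block[OF bohr \<delta> unbounded _ le, of M] by auto
    have "exp (- lam (Suc M)) \<le> exp (- (real j * ln 16))"
      using R[of "Suc M"] by (simp add: M_def)
    also have "\<dots> = (1/16) ^ j" by (simp add: exp_minus exp_of_nat_mult power_one_over inverse_eq_divide)
    finally have "2 * 8 ^ j * exp (- lam (Suc M)) \<le> 2 * 8 ^ j * (1/16) ^ j" by simp
    also have "\<dots> = 2 * (1/2) ^ j" by (simp add: power_mult_distrib[symmetric])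
    finally have e: "2 * 8 ^ j * exp (- lam (Suc M)) \<le> 2 * (1/2) ^ j" .
    have "norm (dir_psum lam q n s) \<le> 3 * (1/2) ^ j" if "Re s > \<delta> + 1" for n s
    proof -
      have "norm (dir_psum lam q n s) \<le> (1/2) ^ j + 2 * 8 ^ j * exp (- lam (Suc M))"
        using q(4,5) \<delta> le that by (intro dir_psum_shift_small[where \<delta> = \<delta>]) auto
      with e show ?thesis by linarith
    qed
    with q have "P j (q, N, z)" unfolding P_def by auto
    with q(5) show ?thesis unfolding M_def by (metis max.coboundedI1)
  qed
  have "\<exists>x. \<forall>j. P j (x j) \<and> Q j (x j) (x (Suc j))"
  proof (rule dependent_nat_choice)
    show "\<exists>x. P 0 x" using step[of 0] by blast
    fix x j assume "P j x"
    obtain q N z where x: "x = (q, N, z)" by (cases x)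
    obtain q' N' z' where y: "P (Suc j) (q', N', z')"
      "\<And>n s. n \<le> N \<Longrightarrow> Re s > 0 \<Longrightarrow> norm (dir_psum lam q' n s) \<le> (1/2) ^ Suc j"
      using step[of "Suc j" N] by blast
    \<comment> \<open>Where the new series is negligible it cannot attain its large partial sum.\<close>
    have "N \<le> N'"
    proof (rule ccontr)
      assume "\<not> N \<le> N'"
      then have "norm (dir_psum lam q' N' z') \<le> (1/2) ^ Suc j"
        using y \<delta> by (auto simp: P_def)
      moreover have "(1/2) ^ Suc j \<le> (1::real)" by (rule power_le_one) auto
      moreover have "(1::real) \<le> 8 ^ j" by simp
      moreover have "8 ^ Suc j / 2 < norm (dir_psum lam q' N' z')"
        using y(1) unfolding P_def prod.case by blast
      ultimately show False unfolding power_Suc by linarith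
    qed
    then have "Q j x (q', N', z')" using y(2) unfolding Q_def x by auto
    with y(1) show "\<exists>y. P (Suc j) y \<and> Q j x y" by blast
  qed
  then obtain x where x: "\<And>j. P j (x j)" "\<And>j. Q j (x j) (x (Suc j))" by blast
  define q where "q j = fst (x j)" for j
  define N where "N j = fst (snd (x j))" for j
  define z where "z j = snd (snd (x j))" for j
  have xeq: "x j = (q j, N j, z j)" for j by (simp add: q_def N_def z_def)
  note PQ = x[unfolded xeq P_def Q_def prod.case]
  have "incseq N" using PQ(2) by (intro incseq_SucI) blast
  show ?thesis
  proof (rule that[of q z N])
    show "norm (dir_psum lam (q j) (N i) s) \<le> (1/2) ^ j" if ij: "i < j" and s: "Re s > 0" for i j s
    proof -
      obtain j' where j': "j = Suc j'" using ij by (cases j) auto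
      then have "N i \<le> N j'" using \<open>incseq N\<close> ij by (auto simp: incseq_def)
      with PQ(2)[of j'] s show ?thesis unfolding j' by blast
    qed
  qed (use PQ(1) in blast)+
qed

text \<open>Only the limit functions are summable in norm on \<open>Re s > 0\<close>. The partial sums are
  summable in norm on \<open>Re s > \<delta> + 1\<close>, where Tannery's theorem shows that the added series \<open>d\<close> converges to the
  sum \<open>f\<close> of the limit functions.\<close>

lemma bohr_partial_sum_bound:
  assumes bohr: "bohr_theorem_holds lam" and \<delta>: "\<delta> > 0"
  shows "\<exists>C>0. \<forall>a B N s. bounded_dir_series lam a B \<and> Re s > \<delta> \<longrightarrow> norm (dir_psum lam a N s) \<le> C * B"
proof (rule ccontr)
  assume "\<not> ?thesis"
  then have unbounded: "\<And>C. C > 0 \<Longrightarrow> \<exists>a B N s. bounded_dir_series lam a B \<and> Re s > \<delta> \<and> norm (dir_psum lam a N s) > C * B"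
    by (meson not_le)
  show False
  proof (rule gliding_hump_sequence[OF bohr \<delta> unbounded])
    fix q :: "nat \<Rightarrow> nat \<Rightarrow> complex" and z :: "nat \<Rightarrow> complex" and N :: "nat \<Rightarrow> nat"
    assume q: "\<And>j. bounded_dir_series lam (q j) ((1/2) ^ j)"
      and z: "\<And>j. Re (z j) > \<delta>" and hump: "\<And>j. norm (dir_psum lam (q j) (N j) (z j)) > 8 ^ j / 2"
      and below: "\<And>j n s. Re s > \<delta> \<Longrightarrow> norm (dir_psum lam (q j) n s) \<le> 8 ^ j"
      and above: "\<And>i j s. i < j \<Longrightarrow> Re s > 0 \<Longrightarrow> norm (dir_psum lam (q j) (N i) s) \<le> (1/2) ^ j"
      and far: "\<And>j n s. Re s > \<delta> + 1 \<Longrightarrow> norm (dir_psum lam (q j) n s) \<le> 3 * (1/2) ^ j"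
    have geo: "(\<lambda>j. (1/2::real) ^ j) sums 2" using geometric_sums[of "1/2::real"] by simp
    note sgeo = sums_summable[OF geo]
    have coeff: "norm (q j n) \<le> (1/2) ^ j" for j n by (rule bounded_dir_series_coeff[OF bohr q])
    have sq: "summable (\<lambda>j. q j n)" for n
      by (rule summable_comparison_test[OF _ sgeo]) (use coeff in auto)
    define d where "d n = (\<Sum>j. q j n)" for n
    have d: "norm (d n) \<le> 2" for n
      using norm_suminf_le[OF coeff[of _ n] sgeo] sums_unique[OF geo] by (simp add: d_def)
    have term_d: "(\<lambda>j. dir_term lam (q j) s n) sums dir_term lam d s n" for s n
      unfolding dir_term_def d_def by (intro sums_mult2 summable_sums sq)
    have psum_d: "(\<lambda>j. dir_psum lam (q j) n s) sums dir_psum lam d n s" for s n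
      by (intro sums_sum term_d)
    define f where "f s = (\<Sum>j. dir_sum lam (q j) s)" for s
    have fj: "norm (dir_sum lam (q j) s) \<le> (1/2) ^ j" "summable (dir_term lam (q j) s)" if "Re s > 0" for j s
      using q[of j] that unfolding bounded_dir_series_def by auto
    have unif_f: "uniform_limit (half_plane 0) (\<lambda>n s. \<Sum>j<n. dir_sum lam (q j) s) f sequentially"
      unfolding f_def by (rule Weierstrass_m_test[OF _ sgeo]) (use fj in auto)
    have hol_f: "f holomorphic_on half_plane 0"
    proof (rule holomorphic_uniform_sequence)
      show "open (half_plane 0)" by (rule open_halfspace_Re_gt)
      show "(\<lambda>s. \<Sum>j<n. dir_sum lam (q j) s) holomorphic_on half_plane 0" for n
        using fj by (intro holomorphic_intros holomorphic_dir_sum[OF freq]) auto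
      fix s assume "s \<in> half_plane 0"
      then obtain r where "r > 0" "cball s r \<subseteq> half_plane 0"
        using open_contains_cball[of "half_plane 0"] open_halfspace_Re_gt[of 0] by blast
      then show "\<exists>r>0. cball s r \<subseteq> half_plane 0 \<and>
          uniform_limit (cball s r) (\<lambda>n s. \<Sum>j<n. dir_sum lam (q j) s) f sequentially"
        using uniform_limit_on_subset[OF unif_f] by blast
    qed
    have bound_f: "norm (f s) \<le> 2" if "Re s > 0" for s
      using norm_suminf_le[OF fj(1)[OF that] sgeo] sums_unique[OF geo] by (simp add: f_def)
    have "dir_term lam d s sums f s" if s: "Re s > \<delta> + 1" for s
    proof -
      have "(\<lambda>n. \<Sum>j. dir_psum lam (q j) n s) \<longlonglongrightarrow> (\<Sum>j. dir_sum lam (q j) s)"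
      proof (rule conjunct2[OF conjunct2[OF tannerys_theorem]])
        show "(\<lambda>n. dir_psum lam (q j) n s) \<longlonglongrightarrow> dir_sum lam (q j) s" for j
          using s \<delta> by (intro dir_psum_tendsto fj) simp
        show "\<forall>\<^sub>F (j, n) in sequentially \<times>\<^sub>F sequentially. norm (dir_psum lam (q j) n s) \<le> 3 * (1/2) ^ j"
          using far[OF s] by (intro always_eventually) auto
        show "summable (\<lambda>j. 3 * (1/2::real) ^ j)" by (intro summable_mult sgeo)
      qed simp
      then show ?thesis
        unfolding f_def[symmetric] sums_unique[OF psum_d, symmetric] sums_def_le .
    qed
    then have conv_d: "summable (dir_term lam d s)" "f s = dir_sum lam d s" if "Re s > \<delta> + 1" for s
      using that by (auto simp: sums_iff dir_sum_def)
    have "d \<in> D_inf_ext lam"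
      unfolding D_inf_ext_def
    proof (intro CollectI conjI exI[of _ f] ballI impI)
      show "\<exists>s. summable (dir_term lam d s)"
        using conv_d(1)[of "of_real (\<delta> + 2)"] by auto
      show "f holomorphic_on half_plane 0" by (rule hol_f)
      show "bounded (f ` half_plane 0)" using bound_f unfolding bounded_iff by auto
      fix s assume s: "s \<in> half_plane 0" "abscissa_conv lam d < ereal (Re s)"
      then obtain \<sigma> where \<sigma>: "\<sigma> < Re s" "\<And>s. Re s > \<sigma> \<Longrightarrow> summable (dir_term lam d s)"
        unfolding abscissa_conv_def Inf_less_iff by auto
      show "f s = dir_sum lam d s"
        by (rule dir_sum_eq_extension[OF freq hol_f, of \<sigma>, OF _ conv_d(2)]) (use s \<sigma> in auto)
    qed
    with bohr have "abscissa_unif lam d \<le> 0" unfolding bohr_theorem_holds_def by blast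
    also have "\<dots> < ereal \<delta>" using \<delta> by simp
    finally have unif_d: "uniformly_convergent_on (half_plane \<delta>) (dir_psum lam d)" by (rule abscissa_unif_lessD)
    then obtain K where K: "\<And>N s. Re s > \<delta> \<Longrightarrow> norm (dir_psum lam d N s) \<le> K"
      using uniformly_bounded_dir_psum[OF d lam_nonneg[OF freq] less_imp_le[OF \<delta>] unif_d] by blast
    have le: "(8::real) ^ j \<le> 4 * (K + 1)" for j
    proof -
      have "8 ^ j / 4 - 1 < norm (\<Sum>i. dir_psum lam (q i) (N j) (z j))"
      proof (rule norm_gt_of_dominant_term)
        show "norm (dir_psum lam (q i) (N j) (z j)) \<le> 8 ^ i" for i by (rule below[OF z])
        show "norm (dir_psum lam (q j) (N j) (z j)) > 8 ^ j / 2" by (rule hump)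
        show "norm (dir_psum lam (q i) (N j) (z j)) \<le> (1/2) ^ i" if "i > j" for i
          using that z[of j] \<delta> by (intro above) auto
      qed
      also have "\<dots> \<le> K" unfolding sums_unique[OF psum_d, symmetric] by (rule K[OF z])
      finally show ?thesis by simp
    qed
    obtain j where "4 * (K + 1) < (8::real) ^ j" using real_arch_pow[of 8] by auto
    with le[of j] show False by linarith
  qed
qed

text \<open>The norm of index \<open>k + 1\<close> always suffices: a translation moves its half-plane to
  \<open>Re s > 0\<close> and leaves the positive distance \<open>1 / k - 1 / (k + 1)\<close>.\<close>

lemma partial_sum_bound_if_bohr_theorem:
  assumes bohr: "bohr_theorem_holds lam" and k: "k \<ge> 1"
  shows "\<exists>l>k. \<exists>C::real. C > 0 \<and> (\<forall>a\<in>D_inf_plus lam.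
      (SUP N. dir_norm lam k (dir_partial N a)) \<le> ereal C * dir_norm lam l a)"
proof -
  define \<tau> where "\<tau> = 1 / real (Suc k)"
  have "\<tau> > 0" "\<tau> < 1 / real k" using k by (auto simp: \<tau>_def divide_strict_left_mono)
  then obtain C where C: "C > 0" "\<And>a B N s. bounded_dir_series lam a B \<Longrightarrow> Re s > 1 / real k - \<tau> \<Longrightarrow>
      norm (dir_psum lam a N s) \<le> C * B"
    using bohr_partial_sum_bound[OF bohr, of "1 / real k - \<tau>"] by auto
  have "(SUP N. dir_norm lam k (dir_partial N a)) \<le> ereal C * dir_norm lam (Suc k) a"
    if a: "a \<in> D_inf_plus lam" for a
  proof (cases "dir_norm lam (Suc k) a")
    case (real B)
    then have B: "norm (dir_sum lam a s) \<le> B" if "Re s > \<tau>" for s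
      using dir_norm_le_iff[of lam "Suc k" a B] that by (simp add: \<tau>_def)
    have "bounded_dir_series lam (dir_shift lam \<tau> a) B"
      using a B \<open>\<tau> > 0\<close> unfolding bounded_dir_series_def D_inf_plus_def
      by (simp add: dir_term_shift dir_sum_shift)
    from C(2)[OF this, of "s - of_real \<tau>" for s]
    have "norm (dir_psum lam a N s) \<le> C * B" if "Re s > 1 / real k" for N s
      using that by (simp add: dir_term_shift)
    then have "dir_norm lam k (dir_partial N a) \<le> ereal (C * B)" for N
      unfolding dir_norm_le_iff by simp
    then show ?thesis unfolding real by (auto intro: SUP_least)
  next
    case MInf
    have "ereal (norm (dir_sum lam a (of_real 2))) \<le> dir_norm lam (Suc k) a"
      unfolding dir_norm_def by (rule SUP_upper) (auto simp: divide_less_eq)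
    then show ?thesis using MInf by simp
  qed (use C in simp)
  then show ?thesis using C(1) by (intro exI[of _ "Suc k"]) auto
qed

end

section \<open>The basis of monomials\<close>

lemma sum_scaled_monomials: "(\<Sum>n\<le>N. dir_scale (\<alpha> n) (dir_monomial n)) = dir_partial N \<alpha>"
proof (induction N)
  case 0
  show ?case by (auto simp: fun_eq_iff dir_scale_def dir_monomial_def dir_partial_def)
next
  case (Suc N)
  show ?case
    unfolding sum.atMost_Suc Suc.IH
    by (auto simp: fun_eq_iff dir_scale_def dir_monomial_def dir_partial_def le_Suc_eq)
qed

lemma dir_diff:
  assumes "summable (dir_term lam a s)" "summable (dir_term lam b s)"
  shows "summable (dir_term lam (a - b) s)" "dir_sum lam (a - b) s = dir_sum lam a s - dir_sum lam b s"
proof -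
  have "dir_term lam (a - b) s = (\<lambda>n. dir_term lam a s n - dir_term lam b s n)"
    by (simp add: fun_eq_iff dir_term_def left_diff_distrib)
  then show "summable (dir_term lam (a - b) s)" "dir_sum lam (a - b) s = dir_sum lam a s - dir_sum lam b s"
    unfolding dir_sum_def using assms by (simp_all add: summable_diff suminf_diff)
qed

lemma D_inf_plus_summable: "a \<in> D_inf_plus lam \<Longrightarrow> Re s > 0 \<Longrightarrow> summable (dir_term lam a s)"
  by (simp add: D_inf_plus_def)

lemma D_inf_plus_bounded:
  "a \<in> D_inf_plus lam \<Longrightarrow> \<sigma> > 0 \<Longrightarrow> \<exists>A. \<forall>s. Re s > \<sigma> \<longrightarrow> norm (dir_sum lam a s) \<le> A"
  by (simp add: D_inf_plus_def bounded_iff)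

lemma D_inf_plus_diff:
  assumes a: "a \<in> D_inf_plus lam" and b: "b \<in> D_inf_plus lam"
  shows "a - b \<in> D_inf_plus lam"
  unfolding D_inf_plus_def
proof (intro CollectI conjI ballI allI impI)
  fix \<sigma> :: real assume \<sigma>: "\<sigma> > 0"
  obtain A where "\<And>s. Re s > \<sigma> \<Longrightarrow> norm (dir_sum lam a s) \<le> A"
    using D_inf_plus_bounded[OF a \<sigma>] by blast
  moreover obtain B where "\<And>s. Re s > \<sigma> \<Longrightarrow> norm (dir_sum lam b s) \<le> B"
    using D_inf_plus_bounded[OF b \<sigma>] by blast
  moreover have "dir_sum lam (a - b) s = dir_sum lam a s - dir_sum lam b s" if "Re s > \<sigma>" for s
    using dir_diff(2) D_inf_plus_summable[OF a, of s] D_inf_plus_summable[OF b, of s] \<sigma> that by simp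
  ultimately have "norm (dir_sum lam (a - b) s) \<le> A + B" if "Re s > \<sigma>" for s
    using that by (auto intro!: order_trans[OF norm_triangle_ineq4] add_mono)
  then show "bounded (dir_sum lam (a - b) ` half_plane \<sigma>)"
    unfolding bounded_iff by auto
qed (use a b in \<open>auto intro: dir_diff D_inf_plus_summable\<close>)

lemma D_inf_plus_partial:
  assumes "\<And>n. lam n \<ge> 0"
  shows "dir_partial N a \<in> D_inf_plus lam"
  unfolding D_inf_plus_def
proof (intro CollectI conjI ballI allI impI)
  show "summable (dir_term lam (dir_partial N a) s)" for s
    using dir_partial_sums by (rule sums_summable)
  fix \<sigma> :: real assume "\<sigma> > 0"
  have "norm (dir_psum lam a N s) \<le> (\<Sum>n\<le>N. norm (a n))" if "Re s > \<sigma>" for s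
    using that \<open>\<sigma> > 0\<close> assms
    by (intro sum_norm_le) (simp add: norm_dir_term mult_left_le)
  then show "bounded (dir_sum lam (dir_partial N a) ` half_plane \<sigma>)"
    unfolding bounded_iff by auto
qed

text \<open>The subbasic open balls have arbitrary centres; by the triangle inequality it is enough to
  test balls centred at the limit.\<close>

lemma limitin_D_inf_plus:
  assumes x: "x \<in> D_inf_plus lam" and X: "\<And>N. X N \<in> D_inf_plus lam"
  shows "limitin (D_inf_plus_topology lam) X x sequentially \<longleftrightarrow>
    (\<forall>k\<ge>1. \<forall>e>0. \<forall>\<^sub>F N in sequentially. dir_norm lam k (X N - x) < ereal e)" (is "?L \<longleftrightarrow> ?R")
proof
  assume L: ?L
  show ?R
  proof (intro allI impI)
    fix k :: nat and e :: real assume ke: "k \<ge> 1" "e > 0"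
    let ?U = "{y \<in> D_inf_plus lam. dir_norm lam k (y - x) < ereal e}"
    have "openin (D_inf_plus_topology lam) ?U"
      unfolding D_inf_plus_topology_def seminorm_topology_def
      by (rule topology_generated_by_Basis) (use x ke in auto)
    moreover have "x \<in> ?U" using x ke by (simp add: dir_norm_zero)
    ultimately have "\<forall>\<^sub>F N in sequentially. X N \<in> ?U" using L unfolding limitin_def by blast
    then show "\<forall>\<^sub>F N in sequentially. dir_norm lam k (X N - x) < ereal e"
      by (rule eventually_mono) simp
  qed
next
  assume R: ?R
  let ?S = "{{y\<in>D_inf_plus lam. dir_norm lam i (y - z) < ereal \<epsilon>} | z i \<epsilon>. z \<in> D_inf_plus lam \<and> i \<in> {1..} \<and> \<epsilon> > 0}"
  have "\<forall>\<^sub>F N in sequentially. X N \<in> U" if "generate_topology_on ?S U" "x \<in> U" for U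
    using that
  proof (induction rule: generate_topology_on.induct)
    case (Int a b)
    then show ?case by (auto intro: eventually_conj)
  next
    case (UN K)
    then obtain k where "k \<in> K" "x \<in> k" by blast
    then have "\<forall>\<^sub>F N in sequentially. X N \<in> k" using UN.IH by blast
    then show ?case by (rule eventually_mono) (use \<open>k \<in> K\<close> in blast)
  next
    case (Basis U)
    then obtain z k \<epsilon> where U: "U = {y\<in>D_inf_plus lam. dir_norm lam k (y - z) < ereal \<epsilon>}"
      and z: "z \<in> D_inf_plus lam" and k: "k \<ge> 1" by auto
    have "dir_norm lam k (x - z) < ereal \<epsilon>" using Basis.prems U by simp
    then obtain r where r: "dir_norm lam k (x - z) < ereal r" "ereal r < ereal \<epsilon>"
      using ereal_dense2 by blast
    have "\<forall>\<^sub>F N in sequentially. dir_norm lam k (X N - x) < ereal ((\<epsilon> - r) / 2)"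
      using R k r(2) by simp
    then show ?case
    proof (rule eventually_mono)
      fix N assume N: "dir_norm lam k (X N - x) < ereal ((\<epsilon> - r) / 2)"
      have "norm (dir_sum lam (X N - z) s) \<le> (\<epsilon> - r) / 2 + r" if s: "Re s > 1 / real k" for s
      proof -
        have s0: "Re s > 0" using s by (meson divide_nonneg_nonneg of_nat_0_le_iff order_le_less_trans zero_le_one)
        note sm = D_inf_plus_summable[OF _ s0]
        have "dir_sum lam (X N - z) s = dir_sum lam (X N - x) s + dir_sum lam (x - z) s"
          by (simp add: dir_diff(2) sm x X z)
        also have "norm \<dots> \<le> (\<epsilon> - r) / 2 + r"
          using less_imp_le[OF N] less_imp_le[OF r(1)] s unfolding dir_norm_le_iff
          by (intro order_trans[OF norm_triangle_ineq] add_mono) blast+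
        finally show ?thesis .
      qed
      then have "dir_norm lam k (X N - z) \<le> ereal ((\<epsilon> - r) / 2 + r)"
        unfolding dir_norm_le_iff by blast
      also have "\<dots> < ereal \<epsilon>" using r(2) by (simp add: field_simps)
      finally show "X N \<in> U" unfolding U using X by simp
    qed
  qed simp
  then show ?L
    unfolding limitin_def topspace_D_inf_plus_topology
    unfolding D_inf_plus_topology_def seminorm_topology_def
    using x openin_topology_generated_by by blast
qed

context
  fixes lam :: "nat \<Rightarrow> real"
  assumes freq: "frequency lam"
begin

lemma schauder_basis_if_bohr_theorem:
  assumes bohr: "bohr_theorem_holds lam"
  shows "schauder_basis dir_scale (D_inf_plus_topology lam) dir_monomial"
  unfolding schauder_basis_def topspace_D_inf_plus_topology sum_scaled_monomials
proof (intro conjI allI ballI ex1I)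
  note partial = D_inf_plus_partial[OF lam_nonneg[OF freq]]
  fix n
  have "dir_monomial n = dir_partial n (dir_monomial n)"
    by (auto simp: fun_eq_iff dir_monomial_def dir_partial_def)
  then show "dir_monomial n \<in> D_inf_plus lam" by (rule ssubst) (rule partial)
next
  note partial = D_inf_plus_partial[OF lam_nonneg[OF freq]]
  fix x assume x: "x \<in> D_inf_plus lam"
  show "limitin (D_inf_plus_topology lam) (\<lambda>N. dir_partial N x) x sequentially"
    unfolding limitin_D_inf_plus[OF x partial]
  proof (intro allI impI)
    fix k :: nat and e :: real assume k: "k \<ge> 1" and e: "e > 0"
    have "uniformly_convergent_on (half_plane (1 / real k)) (dir_psum lam x)"
      by (rule bohr_uniformly_convergent[OF freq bohr x]) (use k in simp)
    then have "uniform_limit (half_plane (1 / real k)) (dir_psum lam x) (dir_sum lam x) sequentially"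
      by (rule uniformly_convergent_dir_psum)
    from uniform_limitD[OF this, of "e / 2"] e
    have "\<forall>\<^sub>F N in sequentially. \<forall>s\<in>half_plane (1 / real k). dist (dir_psum lam x N s) (dir_sum lam x s) < e / 2"
      by simp
    then show "\<forall>\<^sub>F N in sequentially. dir_norm lam k (dir_partial N x - x) < ereal e"
    proof (rule eventually_mono)
      fix N assume N: "\<forall>s\<in>half_plane (1 / real k). dist (dir_psum lam x N s) (dir_sum lam x s) < e / 2"
      have "norm (dir_sum lam (dir_partial N x - x) s) \<le> e / 2" if s: "Re s > 1 / real k" for s
      proof -
        have "Re s > 0" using s by (meson divide_nonneg_nonneg of_nat_0_le_iff order_le_less_trans zero_le_one)
        then have "dir_sum lam (dir_partial N x - x) s = dir_psum lam x N s - dir_sum lam x s"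
          by (simp add: dir_diff(2) D_inf_plus_summable partial x)
        with N s show ?thesis by (auto simp: dist_norm intro: less_imp_le)
      qed
      then have "dir_norm lam k (dir_partial N x - x) \<le> ereal (e / 2)" unfolding dir_norm_le_iff by blast
      also have "\<dots> < ereal e" using e by simp
      finally show "dir_norm lam k (dir_partial N x - x) < ereal e" .
    qed
  qed
  fix \<alpha> assume "limitin (D_inf_plus_topology lam) (\<lambda>N. dir_partial N \<alpha>) x sequentially"
  then have lim: "\<And>e. e > 0 \<Longrightarrow> \<forall>\<^sub>F N in sequentially. dir_norm lam 1 (dir_partial N \<alpha> - x) < ereal e"
    unfolding limitin_D_inf_plus[OF x partial] by blast
  show "\<alpha> = x"
  proof
    fix m
    have "norm (\<alpha> m - x m) * exp (- (lam m * 2)) \<le> 0"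
    proof (rule field_le_epsilon)
      fix e :: real assume e: "e > 0"
      obtain N where N: "m \<le> N" "dir_norm lam 1 (dir_partial N \<alpha> - x) < ereal e"
        using eventually_happens'[OF sequentially_bot eventually_conj[OF eventually_ge_at_top[of m] lim[OF e]]]
        by blast
      have "norm ((dir_partial N \<alpha> - x) m) * exp (- (lam m * 2)) \<le> e"
        using less_imp_le[OF N(2)] unfolding dir_norm_le_iff
        by (intro bohr_coeff_bound[OF freq bohr D_inf_plus_diff[OF partial x]]) auto
      with N(1) show "norm (\<alpha> m - x m) * exp (- (lam m * 2)) \<le> 0 + e"
        by (simp add: dir_partial_def)
    qed
    then show "\<alpha> m = x m" by (simp add: mult_le_0_iff)
  qed
qed

end

theorem theorem5p5:
  fixes lam :: "nat \<Rightarrow> real"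
  assumes "frequency lam"
  shows "(bohr_theorem_holds lam \<longleftrightarrow>
           (\<forall>k\<ge>1. \<exists>l>k. \<exists>C::real. C > 0 \<and>
              (\<forall>a\<in>D_inf_plus lam.
                 (SUP N. dir_norm lam k (dir_partial N a)) \<le> ereal C * dir_norm lam l a)))
       \<and> (bohr_theorem_holds lam \<longrightarrow>
            schauder_basis dir_scale (D_inf_plus_topology lam) dir_monomial)"
  using bohr_theorem_if_partial_sum_bound[OF assms] partial_sum_bound_if_bohr_theorem[OF assms]
    schauder_basis_if_bohr_theorem[OF assms] by blast

end
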